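(* Every nonzero odd-quadratic even-symplectic Lie superalgebra $(\mathfrak g,B,\omega)$ is a generalized odd double extension of an odd-quadratic even-symplectic Lie superalgebra $(\mathfrak h,B_{\mathfrak h},\omega_{\mathfrak h})$, where $\dim\mathfrak h=\dim\mathfrak g-4$, by the two-dimensional abelian Lie superalgebra.
   Context: All Lie superalgebras are finite dimensional over an algebraically closed field $\mathbb K$ of characteristic zero; $|x|\in\mathbb Z_2$ is the degree of a homogeneous $X$. A bilinear form $\theta$ is even if $\theta(\mathfrak g_\alpha,\mathfrak g_\beta)=\{0\}$ for $\alpha\ne\beta$, odd if $\theta(\mathfrak g_\alpha,\mathfrak g_\alpha)=\{0\}$ for all $\alpha$. An odd-invariant scalar product $B$ is an odd, supersymmetric ($B(X,Y)=(-1)^{|x||y|}B(Y,X)$), invariant ($B([X,Y],Z)=B(X,[Y,Z])$), non-degenerate bilinear form. An even-symplectic form is an even, skew-supersymmetric ($\omega(X,Y)=-(-1)^{|x||y|}\omega(Y,X)$), non-degenerate form with $(-1)^{|z||x|}\omega(X,[Y,Z])+(-1)^{|x||y|}\omega(Y,[Z,X])+(-1)^{|y||z|}\omega(Z,[X,Y])=0$. An odd-quadratic even-symplectic Lie superalgebra $(\mathfrak g,B,\omega)$ carries both; then there is a unique odd invertible superderivation $\delta$ with $\omega(X,Y)=B(\delta(X),Y)$, and it is skew-supersymmetric. A superderivation $\Delta$ of degree $d$ satisfies $\Delta(\mathfrak g_\alpha)\subseteq \mathfrak g_{\alpha+d}$ and $\Delta[X,Y]=[\Delta(X),Y]+(-1)^{d|x|}[X,\Delta(Y)]$;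 it is skew-supersymmetric for $B$ if $B(\Delta(X),Y)=-(-1)^{d|x|}B(X,\Delta(Y))$. Brackets of endomorphisms are supercommutators. Generalized odd double extension by the two-dimensional abelian Lie superalgebra $\mathbb Ke_0\oplus\mathbb Ke_1$ ($e_0$ even, $e_1$ odd). Let $(\mathfrak h,B,\omega)$ be odd-quadratic even-symplectic with associated odd invertible superderivation $\delta$. Let $D$ (even), $\bar D$ (odd) be skew-supersymmetric superderivations of $(\mathfrak h,B)$, $x_0,c_0\in\mathfrak h_{\bar0}$, $x_1,c_1\in\mathfrak h_{\bar1}$, $k,\alpha\in\mathbb K$, $\lambda\in\mathbb K\setminus\{0\}$ with $\bar D^2=\frac12\mathrm{ad}(x_0)$, $\bar D(x_0)=0$, $[D,\bar D]=\mathrm{ad}(x_1)$, $D(x_0)=2\bar D(x_1)$, $B(x_0,x_1)=0$, and $\mathrm{ad}(c_0)=[\delta,\bar D]-\lambda D$, $\mathrm{ad}(c_1)=[\delta,D]+\lambda\bar D$, $\delta(x_0)=-2\bar D(c_0)+2\lambda x_1$, $\delta(x_1)=D(c_0)+\bar D(c_1)-\lambda x_0$, $\lambda k=B(c_1,x_0)-2B(x_1,c_0)$. On $\mathfrak t=\mathbb Ke_0^*\oplus\mathbb Ke_1^*\oplus\mathfrak h\oplus\mathbb Ke_0\oplus\mathbb Ke_1$ ($e_0^*$ even, $e_1^*$ odd, both central) put $[X,Y]=[X,Y]_{\mathfrak h}+B(\bar D(X),Y)e_0^*+B(D(X),Y)e_1^*$, $[e_0,X]=D(X)-B(x_1,X)e_0^*$,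 $[e_1,X]=\bar D(X)+B(x_0,X)e_0^*+B(x_1,X)e_1^*$, $[e_0,e_1]=x_1$, $[e_1,e_1]=ke_0^*+x_0$, $[e_0,e_0]=0$; let $\gamma$ be the supersymmetric form with $\gamma|_{\mathfrak h\times\mathfrak h}=B$, $\gamma(e_0^*,e_1)=1=\gamma(e_1^*,e_0)$, other pairings zero; let $\Delta(e_0^* )=\lambda e_1^*$, $\Delta(e_1^* )=\lambda e_0^*$, $\Delta(e_0)=c_1-\lambda e_1$, $\Delta(e_1)=\alpha e_0^*+c_0+\lambda e_0$, $\Delta(X)=B(c_0,X)e_0^*+\delta(X)-B(c_1,X)e_1^*$. Then $(\mathfrak t,\gamma,\Omega)$ with $\Omega(X,Y)=\gamma(\Delta(X),Y)$ is an odd-quadratic even-symplectic Lie superalgebra, called the generalized odd double extension of $(\mathfrak h,B,\omega)$ by the two-dimensional abelian Lie superalgebra by means of $(D,\bar D,x_0,x_1,c_0,c_1,\lambda)$. "Is a generalized odd double extension" means up to isomorphism preserving both forms. *)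

theory Defs
  imports
    "HOL-Computational_Algebra.Polynomial"
    "HOL-Library.Z2"
    "HOL-Library.Product_Plus"
begin

text \<open>
  Superspaces live on a carrier inside an ambient abelian group type: \<open>part L 0\<close> and \<open>part L 1\<close> are
  the even and odd subspaces, and \<open>supercarrier L\<close> is their sum.  Degrees are elements of the field
  \<^typ>\<open>bit\<close>, so that \<open>a + b\<close> and \<open>a * b\<close> are computed in \<open>Z/2\<close>.  The values of the operations
  outside \<open>supercarrier L\<close> are irrelevant.
\<close>

record ('k, 'v) superalgebra =
  smul :: "'k \<Rightarrow> 'v \<Rightarrow> 'v"
  part :: "bit \<Rightarrow> 'v set"
  bracket :: "'v \<Rightarrow> 'v \<Rightarrow> 'v"

record ('k, 'v) superalgebra_forms = "('k, 'v) superalgebra" +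
  quad :: "'v \<Rightarrow> 'v \<Rightarrow> 'k"
  symp :: "'v \<Rightarrow> 'v \<Rightarrow> 'k"

definition supercarrier :: "('k, 'v::ab_group_add, 'm) superalgebra_scheme \<Rightarrow> 'v set" where
  "supercarrier L = {x + y | x y. x \<in> part L 0 \<and> y \<in> part L 1}"

text \<open>\<open>signed d x\<close> is \<open>(-1)^d x\<close>, for scalars as well as for vectors.\<close>

definition signed :: "bit \<Rightarrow> 'a::ab_group_add \<Rightarrow> 'a" where
  "signed d x = (if d = 0 then x else - x)"

definition linear_on ::
  "('k \<Rightarrow> 'v::ab_group_add \<Rightarrow> 'v) \<Rightarrow> ('k \<Rightarrow> 'w::ab_group_add \<Rightarrow> 'w) \<Rightarrow> 'v set \<Rightarrow> ('v \<Rightarrow> 'w) \<Rightarrow> bool"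
where
  "linear_on s1 s2 V f \<longleftrightarrow>
     (\<forall>x\<in>V. \<forall>y\<in>V. f (x + y) = f x + f y) \<and> (\<forall>c. \<forall>x\<in>V. f (s1 c x) = s2 c (f x))"

definition bilinear_on ::
  "('k \<Rightarrow> 'v::ab_group_add \<Rightarrow> 'v) \<Rightarrow> ('k \<Rightarrow> 'w::ab_group_add \<Rightarrow> 'w) \<Rightarrow> 'v set \<Rightarrow> ('v \<Rightarrow> 'v \<Rightarrow> 'w) \<Rightarrow> bool"
where
  "bilinear_on s1 s2 V b \<longleftrightarrow>
     (\<forall>x\<in>V. linear_on s1 s2 V (\<lambda>y. b x y)) \<and> (\<forall>y\<in>V. linear_on s1 s2 V (\<lambda>x. b x y))"

locale lie_superalgebra =
  fixes L :: "('k::{alg_closed_field, field_char_0}, 'v::ab_group_add, 'm) superalgebra_scheme"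
  assumes vector_space: "vector_space (smul L)"
    and subspace: "module.subspace (smul L) (part L a)"
    and direct: "part L 0 \<inter> part L 1 = {0}"
    and finite_dim: "\<exists>S. finite S \<and> supercarrier L = module.span (smul L) S"
    and bilinear: "bilinear_on (smul L) (smul L) (supercarrier L) (bracket L)"
    and degree: "x \<in> part L a \<Longrightarrow> y \<in> part L b \<Longrightarrow> bracket L x y \<in> part L (a + b)"
    and skew: "x \<in> part L a \<Longrightarrow> y \<in> part L b \<Longrightarrow>
      bracket L x y = - signed (a * b) (bracket L y x)"
    and jacobi: "x \<in> part L a \<Longrightarrow> y \<in> part L b \<Longrightarrow> z \<in> part L c \<Longrightarrow>
      signed (c * a) (bracket L x (bracket L y z))
      + signed (a * b) (bracket L y (bracket L z x))
      + signed (b * c) (bracket L z (bracket L x y)) = 0"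

definition nondegenerate_on :: "'v set \<Rightarrow> ('v::zero \<Rightarrow> 'v \<Rightarrow> 'k::zero) \<Rightarrow> bool" where
  "nondegenerate_on V b \<longleftrightarrow> (\<forall>x\<in>V. (\<forall>y\<in>V. b x y = 0) \<longrightarrow> x = 0)"

definition odd_invariant_scalar_product ::
  "('k::field, 'v::ab_group_add, 'm) superalgebra_scheme \<Rightarrow> ('v \<Rightarrow> 'v \<Rightarrow> 'k) \<Rightarrow> bool"
where
  "odd_invariant_scalar_product L b \<longleftrightarrow>
     bilinear_on (smul L) (*) (supercarrier L) b \<and>
     (\<forall>i. \<forall>x\<in>part L i. \<forall>y\<in>part L i. b x y = 0) \<and>
     (\<forall>i j. \<forall>x\<in>part L i. \<forall>y\<in>part L j. b x y = signed (i * j) (b y x)) \<and>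
     (\<forall>x\<in>supercarrier L. \<forall>y\<in>supercarrier L. \<forall>z\<in>supercarrier L. b (bracket L x y) z = b x (bracket L y z)) \<and>
     nondegenerate_on (supercarrier L) b"

definition even_symplectic_form ::
  "('k::field, 'v::ab_group_add, 'm) superalgebra_scheme \<Rightarrow> ('v \<Rightarrow> 'v \<Rightarrow> 'k) \<Rightarrow> bool"
where
  "even_symplectic_form L w \<longleftrightarrow>
     bilinear_on (smul L) (*) (supercarrier L) w \<and>
     (\<forall>i j. i \<noteq> j \<longrightarrow> (\<forall>x\<in>part L i. \<forall>y\<in>part L j. w x y = 0)) \<and>
     (\<forall>i j. \<forall>x\<in>part L i. \<forall>y\<in>part L j. w x y = - signed (i * j) (w y x)) \<and>
     nondegenerate_on (supercarrier L) w \<and>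
     (\<forall>i j l. \<forall>x\<in>part L i. \<forall>y\<in>part L j. \<forall>z\<in>part L l.
        signed (l * i) (w x (bracket L y z))
        + signed (i * j) (w y (bracket L z x))
        + signed (j * l) (w z (bracket L x y)) = 0)"

definition odd_quadratic_even_symplectic ::
  "('k::{alg_closed_field, field_char_0}, 'v::ab_group_add) superalgebra_forms \<Rightarrow> bool"
where
  "odd_quadratic_even_symplectic L \<longleftrightarrow>
     lie_superalgebra L \<and> odd_invariant_scalar_product L (quad L) \<and> even_symplectic_form L (symp L)"

definition superderivation ::
  "('k, 'v::ab_group_add, 'm) superalgebra_scheme \<Rightarrow> bit \<Rightarrow> ('v \<Rightarrow> 'v) \<Rightarrow> bool"
where
  "superderivation L d \<Delta> \<longleftrightarrow>
     linear_on (smul L) (smul L) (supercarrier L) \<Delta> \<and>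
     (\<forall>i. \<Delta> ` part L i \<subseteq> part L (i + d)) \<and>
     (\<forall>i. \<forall>x\<in>part L i. \<forall>y\<in>supercarrier L.
        \<Delta> (bracket L x y) = bracket L (\<Delta> x) y + signed (d * i) (bracket L x (\<Delta> y)))"

definition skew_supersymmetric ::
  "('k::ab_group_add, 'v::ab_group_add) superalgebra_forms \<Rightarrow> bit \<Rightarrow> ('v \<Rightarrow> 'v) \<Rightarrow> bool"
where
  "skew_supersymmetric L d \<Delta> \<longleftrightarrow>
     (\<forall>i. \<forall>x\<in>part L i. \<forall>y\<in>supercarrier L. quad L (\<Delta> x) y = - signed (d * i) (quad L x (\<Delta> y)))"

text \<open>The supercommutator of endomorphisms \<open>S\<close>, \<open>T\<close> of degrees \<open>s\<close>, \<open>t\<close>.\<close>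

definition supercommutator ::
  "bit \<Rightarrow> bit \<Rightarrow> ('v::ab_group_add \<Rightarrow> 'v) \<Rightarrow> ('v \<Rightarrow> 'v) \<Rightarrow> 'v \<Rightarrow> 'v"
where
  "supercommutator s t S T x = S (T x) - signed (s * t) (T (S x))"

definition associated_superderivation ::
  "('k, 'v::ab_group_add) superalgebra_forms \<Rightarrow> ('v \<Rightarrow> 'v) \<Rightarrow> bool"
where
  "associated_superderivation L \<delta> \<longleftrightarrow>
     superderivation L 1 \<delta> \<and> bij_betw \<delta> (supercarrier L) (supercarrier L) \<and>
     (\<forall>x\<in>supercarrier L. \<forall>y\<in>supercarrier L. symp L x y = quad L (\<delta> x) y)"

locale double_extension_data =
  fixes h :: "('k::{alg_closed_field, field_char_0}, 'v::ab_group_add) superalgebra_forms"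
    and \<delta> D Db :: "'v \<Rightarrow> 'v" and x0 x1 c0 c1 :: 'v and k lam :: 'k
  assumes base: "odd_quadratic_even_symplectic h"
    and delta: "associated_superderivation h \<delta>"
    and D: "superderivation h 0 D" "skew_supersymmetric h 0 D"
    and Db: "superderivation h 1 Db" "skew_supersymmetric h 1 Db"
    and even_elements: "x0 \<in> part h 0" "c0 \<in> part h 0"
    and odd_elements: "x1 \<in> part h 1" "c1 \<in> part h 1"
    and lam_nonzero: "lam \<noteq> 0"
    and Db_square: "\<forall>x\<in>supercarrier h. Db (Db x) = smul h (1/2) (bracket h x0 x)"
    and Db_x0: "Db x0 = 0"
    and D_Db: "\<forall>x\<in>supercarrier h. supercommutator 0 1 D Db x = bracket h x1 x"
    and D_x0: "D x0 = smul h 2 (Db x1)"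
    and quad_x0_x1: "quad h x0 x1 = 0"
    and ad_c0: "\<forall>x\<in>supercarrier h. bracket h c0 x = supercommutator 1 1 \<delta> Db x - smul h lam (D x)"
    and ad_c1: "\<forall>x\<in>supercarrier h. bracket h c1 x = supercommutator 1 0 \<delta> D x + smul h lam (Db x)"
    and delta_x0: "\<delta> x0 = - smul h 2 (Db c0) + smul h (2 * lam) x1"
    and delta_x1: "\<delta> x1 = D c0 + Db c1 - smul h lam x0"
    and lam_k: "lam * k = quad h c1 x0 - 2 * quad h x1 c0"

text \<open>The parity involution \<open>X \<mapsto> (-1)^|X| X\<close>.\<close>

definition parity_involution ::
  "('k, 'v::ab_group_add, 'm) superalgebra_scheme \<Rightarrow> 'v \<Rightarrow> 'v"
where
  "parity_involution L v = (THE w. \<exists>x\<in>part L 0. \<exists>y\<in>part L 1. v = x + y \<and> w = x - y)"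

text \<open>
  The tuple \<open>(p, q, X, a, b)\<close> stands for \<open>p e0* + q e1* + X + a e0 + b e1\<close>.
\<close>

type_synonym ('k, 'v) ext = "'k \<times> 'k \<times> 'v \<times> 'k \<times> 'k"

definition ext_smul :: "('k::field \<Rightarrow> 'v \<Rightarrow> 'v) \<Rightarrow> 'k \<Rightarrow> ('k, 'v) ext \<Rightarrow> ('k, 'v) ext" where
  "ext_smul s r = (\<lambda>(p, q, X, a, b). (r * p, r * q, s r X, r * a, r * b))"

definition ext_part ::
  "('k::field, 'v, 'm) superalgebra_scheme \<Rightarrow> bit \<Rightarrow> ('k, 'v) ext set"
where
  "ext_part h i =
     (if i = 0 then {(p, 0, X, a, 0) | p X a. X \<in> part h 0}
      else {(0, q, X, 0, b) | q X b. X \<in> part h 1})"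

text \<open>
  The brackets \<open>[e0, X]\<close> and \<open>[e1, X]\<close> with \<open>X\<close> in \<open>h\<close>.
\<close>

definition ext_e0 ::
  "('k::field, 'v) superalgebra_forms \<Rightarrow> ('v \<Rightarrow> 'v) \<Rightarrow> 'v \<Rightarrow> 'v \<Rightarrow> ('k, 'v) ext"
where
  "ext_e0 h D x1 X = (- quad h x1 X, 0, D X, 0, 0)"

definition ext_e1 ::
  "('k::field, 'v) superalgebra_forms \<Rightarrow> ('v \<Rightarrow> 'v) \<Rightarrow> 'v \<Rightarrow> 'v \<Rightarrow> 'v \<Rightarrow> ('k, 'v) ext"
where
  "ext_e1 h Db x0 x1 X = (quad h x0 X, quad h x1 X, Db X, 0, 0)"

text \<open>
  The bilinear extension of the prescribed brackets.  Skew-supersymmetry gives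
  \<open>[X, e0] = -[e0, X]\<close>, \<open>[X, e1] = -(-1)^|X| [e1, X]\<close> and \<open>[e1, e0] = -[e0, e1]\<close>.
\<close>

definition ext_bracket ::
  "('k::field, 'v::ab_group_add) superalgebra_forms \<Rightarrow> ('v \<Rightarrow> 'v) \<Rightarrow> ('v \<Rightarrow> 'v) \<Rightarrow> 'v \<Rightarrow> 'v \<Rightarrow> 'k \<Rightarrow>
   ('k, 'v) ext \<Rightarrow> ('k, 'v) ext \<Rightarrow> ('k, 'v) ext"
where
  "ext_bracket h D Db x0 x1 k = (\<lambda>(p, q, X, a, b) (p', q', Y, a', b').
     (quad h (Db X) Y, quad h (D X) Y, bracket h X Y, 0, 0)
     + ext_smul (smul h) a (ext_e0 h D x1 Y)
     + ext_smul (smul h) b (ext_e1 h Db x0 x1 Y)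
     - ext_smul (smul h) a' (ext_e0 h D x1 X)
     - ext_smul (smul h) b' (ext_e1 h Db x0 x1 (parity_involution h X))
     + ext_smul (smul h) (a * b' - b * a') (0, 0, x1, 0, 0)
     + ext_smul (smul h) (b * b') (k, 0, x0, 0, 0))"

text \<open>
  The form \<open>\<gamma>\<close> only pairs even with odd vectors, so its supersymmetry involves no sign.
\<close>

definition ext_quad ::
  "('k::field, 'v) superalgebra_forms \<Rightarrow> ('k, 'v) ext \<Rightarrow> ('k, 'v) ext \<Rightarrow> 'k"
where
  "ext_quad h = (\<lambda>(p, q, X, a, b) (p', q', Y, a', b').
     quad h X Y + p * b' + b * p' + q * a' + a * q')"

definition ext_delta ::
  "('k::field, 'v::ab_group_add) superalgebra_forms \<Rightarrow> ('v \<Rightarrow> 'v) \<Rightarrow> 'v \<Rightarrow> 'v \<Rightarrow> 'k \<Rightarrow> 'k \<Rightarrow>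
   ('k, 'v) ext \<Rightarrow> ('k, 'v) ext"
where
  "ext_delta h \<delta> c0 c1 \<alpha> lam = (\<lambda>(p, q, X, a, b).
     ext_smul (smul h) p (0, lam, 0, 0, 0)
     + ext_smul (smul h) q (lam, 0, 0, 0, 0)
     + (quad h c0 X, - quad h c1 X, \<delta> X, 0, 0)
     + ext_smul (smul h) a (0, 0, c1, 0, - lam)
     + ext_smul (smul h) b (\<alpha>, 0, c0, lam, 0))"

definition double_extension ::
  "('k::field, 'v::ab_group_add) superalgebra_forms \<Rightarrow>
   ('v \<Rightarrow> 'v) \<Rightarrow> ('v \<Rightarrow> 'v) \<Rightarrow> ('v \<Rightarrow> 'v) \<Rightarrow> 'v \<Rightarrow> 'v \<Rightarrow> 'v \<Rightarrow> 'v \<Rightarrow> 'k \<Rightarrow> 'k \<Rightarrow> 'k \<Rightarrow>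
   ('k, ('k, 'v) ext) superalgebra_forms"
where
  "double_extension h \<delta> D Db x0 x1 c0 c1 k \<alpha> lam =
     \<lparr> smul = ext_smul (smul h),
       part = ext_part h,
       bracket = ext_bracket h D Db x0 x1 k,
       quad = ext_quad h,
       symp = (\<lambda>u v. ext_quad h (ext_delta h \<delta> c0 c1 \<alpha> lam u) v) \<rparr>"

definition form_isomorphic ::
  "('k, 'v::ab_group_add) superalgebra_forms \<Rightarrow> ('k, 'w::ab_group_add) superalgebra_forms \<Rightarrow> bool"
where
  "form_isomorphic L M \<longleftrightarrow>
     (\<exists>f. bij_betw f (supercarrier L) (supercarrier M) \<and>
          linear_on (smul L) (smul M) (supercarrier L) f \<and>
          (\<forall>i. f ` part L i = part M i) \<and>
          (\<forall>x\<in>supercarrier L. \<forall>y\<in>supercarrier L.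
             f (bracket L x y) = bracket M (f x) (f y) \<and>
             quad L x y = quad M (f x) (f y) \<and>
             symp L x y = symp M (f x) (f y)))"

definition generalized_odd_double_extension ::
  "('k::{alg_closed_field, field_char_0}, 'w::ab_group_add) superalgebra_forms \<Rightarrow>
   ('k, 'v::ab_group_add) superalgebra_forms \<Rightarrow> bool"
where
  "generalized_odd_double_extension g h \<longleftrightarrow>
     (\<exists>\<delta> D Db x0 x1 c0 c1 k \<alpha> lam.
        double_extension_data h \<delta> D Db x0 x1 c0 c1 k lam \<and>
        form_isomorphic g (double_extension h \<delta> D Db x0 x1 c0 c1 k \<alpha> lam))"

end

theory Submission
  imports Defs
begin

text \<open>
  Let \<open>\<delta>\<close> be the odd invertible superderivation with \<open>\<omega> x y = B (\<delta> x) y\<close>.  The argument has two halves: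
  the centre contains a \<open>\<delta>\<close>-stable plane of dimension \<open>(1|1)\<close> that is isotropic for \<open>B\<close>, and reduction
  of the algebra along such a plane inverts the double extension.

  Existence of the plane.  The square \<open>\<delta>\<^sup>2\<close> is an even invertible derivation, so the bracket maps the
  generalized eigenspaces of \<open>\<mu>\<close> and \<open>\<nu>\<close> into that of \<open>\<mu> + \<nu>\<close>.  In characteristic zero and with
  \<open>\<mu> \<noteq> 0\<close> the numbers \<open>\<nu> + n \<mu>\<close> are pairwise distinct, hence almost all of them are not
  eigenvalues, and the adjoint action of every homogeneous generalized eigenvector is nilpotent.
  These vectors span the algebra and are closed under the bracket, so a version of Engel's theorem
  (lemma \<open>engel\<close>) gives a non-zero central vector.  Since \<open>\<delta>\<close> preserves the centre and swaps
  parities, \<open>\<delta>\<^sup>2\<close> has an even central eigenvector \<open>z0\<close>, with eigenvalue \<open>lam\<^sup>2 \<noteq> 0\<close>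
  (lemma \<open>central_eigenvector\<close>).  With \<open>z1 = \<delta> z0 / lam\<close> the plane spanned by \<open>z0, z1\<close> is
  \<open>\<delta>\<close>-stable; it is isotropic because \<open>B (\<delta> z0) z0 = \<omega> z0 z0\<close> vanishes by skew symmetry.

  Reduction.  Non-degeneracy provides \<open>e0, e1\<close> that complete \<open>z0, z1\<close> to a hyperbolic basis of a
  four-dimensional subspace.  Let \<open>H\<close> be its orthogonal complement and \<open>\<pi>\<close> the orthogonal projection
  onto \<open>H\<close>.  As \<open>z0\<close> and \<open>z1\<close> are central, invariance of \<open>B\<close> makes every bracket orthogonal to them; hence
  a bracket and its projection differ by a central vector and act in the same way.  Therefore \<open>H\<close> with
  the bracket \<open>\<pi> [x, y]\<close> is again such an algebra, and each condition on the double extension data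
  is the \<open>H\<close>-component, or the coefficient at a frame vector, of a Jacobi identity, of the derivation
  property of \<open>\<delta>\<close>, or of invariance, evaluated at the frame vectors.  Sending a vector to its coordinates
  along \<open>z0, z1, H, e0, e1\<close> is the required isomorphism.
\<close>

section \<open>Eigenvectors of an operator on a finite-dimensional subspace\<close>

text \<open>
  Linearity is required on \<open>U\<close> only, because the operators considered later are unspecified outside the
  carrier of an algebra; \<open>F\<close> witnesses that \<open>U\<close> has finite dimension.
\<close>

locale stable_subspace = vector_space scale
  for scale :: "'k::alg_closed_field \<Rightarrow> 'v::ab_group_add \<Rightarrow> 'v" (infixr "*s" 75) +
  fixes T :: "'v \<Rightarrow> 'v" and U F :: "'v set"
  assumes subspace_U: "subspace U"
    and linear_T: "linear_on scale scale U T"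
    and T_in: "x \<in> U \<Longrightarrow> T x \<in> U"
    and finite_F: "finite F" and U_le: "U \<subseteq> span F"
begin

lemma U_simps [simp, intro]:
  "0 \<in> U" "x \<in> U \<Longrightarrow> y \<in> U \<Longrightarrow> x + y \<in> U" "x \<in> U \<Longrightarrow> y \<in> U \<Longrightarrow> x - y \<in> U"
  "x \<in> U \<Longrightarrow> c *s x \<in> U" "x \<in> U \<Longrightarrow> T x \<in> U"
  using subspace_U T_in by (auto intro: subspace_0 subspace_add subspace_diff subspace_scale)

lemma T_add: "x \<in> U \<Longrightarrow> y \<in> U \<Longrightarrow> T (x + y) = T x + T y"
  and T_scale: "x \<in> U \<Longrightarrow> T (c *s x) = c *s T x"
  using linear_T by (auto simp: linear_on_def)

lemma T_0 [simp]: "T 0 = 0"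
  using T_scale[of 0 0] by simp

lemma T_diff: "x \<in> U \<Longrightarrow> y \<in> U \<Longrightarrow> T (x - y) = T x - T y"
  using T_add[of "x - y" y] by (simp add: algebra_simps)

lemma T_sum: "(\<And>i. i \<in> I \<Longrightarrow> f i \<in> U) \<Longrightarrow> T (sum f I) = (\<Sum>i\<in>I. T (f i))"
proof (induction I rule: infinite_finite_induct)
  case (insert i I)
  then show ?case using subspace_sum[OF subspace_U, of I f] by (simp add: T_add)
qed auto

lemma T_pow_in [simp]: "x \<in> U \<Longrightarrow> (T ^^ n) x \<in> U"
  by (induction n) auto

text \<open>
  The value at \<open>x\<close> of the operator \<open>p(T)\<close>.
\<close>

definition poly_op :: "'k poly \<Rightarrow> 'v \<Rightarrow> 'v" where
  "poly_op p x = (\<Sum>i\<le>degree p. coeff p i *s (T ^^ i) x)"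

lemma poly_op_bound: "degree p \<le> n \<Longrightarrow> poly_op p x = (\<Sum>i\<le>n. coeff p i *s (T ^^ i) x)"
  unfolding poly_op_def by (rule sum.mono_neutral_left) (auto simp: coeff_eq_0)

lemma poly_op_in: "x \<in> U \<Longrightarrow> poly_op p x \<in> U"
  unfolding poly_op_def by (intro subspace_sum subspace_U) auto

lemma poly_op_linear_factor:
  assumes x: "x \<in> U"
  shows "poly_op ([:- \<mu>, 1:] * q) x = T (poly_op q x) - \<mu> *s poly_op q x"
proof -
  define n where "n = degree q"
  have "T (poly_op q x) = (\<Sum>i\<le>n. coeff q i *s (T ^^ Suc i) x)"
    unfolding poly_op_def n_def using x by (subst T_sum) (auto simp: T_scale)
  also have "\<dots> = (\<Sum>i\<le>Suc n. coeff (pCons 0 q) i *s (T ^^ i) x)"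
    by (subst sum.atMost_Suc_shift) simp
  finally have T: "T (poly_op q x) = (\<Sum>i\<le>Suc n. coeff (pCons 0 q) i *s (T ^^ i) x)" .
  have eq: "[:- \<mu>, 1:] * q = pCons 0 q - smult \<mu> q" by simp
  have "degree ([:- \<mu>, 1:] * q) \<le> Suc n"
    unfolding n_def by (rule order_trans[OF degree_mult_le]) simp
  then have "poly_op ([:- \<mu>, 1:] * q) x = (\<Sum>i\<le>Suc n. coeff (pCons 0 q - smult \<mu> q) i *s (T ^^ i) x)"
    by (subst poly_op_bound[where n = "Suc n"]) (simp_all only: eq)
  also have "\<dots> = T (poly_op q x) - \<mu> *s (\<Sum>i\<le>Suc n. coeff q i *s (T ^^ i) x)"
    unfolding T by (simp only: coeff_diff coeff_smult scale_left_diff_distrib sum_subtractf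
        scale_sum_right scale_scale)
  also have "(\<Sum>i\<le>Suc n. coeff q i *s (T ^^ i) x) = poly_op q x"
    by (rule poly_op_bound[symmetric]) (simp add: n_def)
  finally show ?thesis .
qed

lemma ex_annihilating_poly:
  assumes x: "x \<in> U"
  shows "\<exists>p. p \<noteq> 0 \<and> poly_op p x = 0"
proof (cases "inj_on (\<lambda>i. (T ^^ i) x) {..card F}")
  case True
  let ?f = "\<lambda>i. (T ^^ i) x"
  have "dependent (?f ` {..card F})"
  proof (rule ccontr)
    assume "independent (?f ` {..card F})"
    moreover have "?f ` {..card F} \<subseteq> span F" using U_le x by auto
    ultimately have "card (?f ` {..card F}) \<le> card F"
      using independent_span_bound[OF finite_F] by blast
    then show False unfolding card_image[OF True] by simp
  qed
  then obtain u v where uv: "v \<in> ?f ` {..card F}" "u v \<noteq> 0" "(\<Sum>v\<in>?f ` {..card F}. u v *s v) = 0"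
    using dependent_finite[of "?f ` {..card F}"] by blast
  then obtain i where u: "i \<le> card F" "u (?f i) \<noteq> 0" by blast
  define p where "p = (\<Sum>j\<le>card F. monom (u (?f j)) j)"
  have c: "coeff p j = (if j \<le> card F then u (?f j) else 0)" for j
    by (simp add: p_def coeff_sum)
  have "degree p \<le> card F" by (rule degree_le) (simp add: c)
  then have "poly_op p x = (\<Sum>j\<le>card F. u (?f j) *s ?f j)"
    by (subst poly_op_bound) (auto simp: c)
  also have "\<dots> = 0" using uv(3) unfolding sum.reindex[OF True] o_def .
  finally have "poly_op p x = 0" .
  moreover have "p \<noteq> 0" using c[of i] u by auto
  ultimately show ?thesis by blast
next
  case False
  then obtain i j where ij: "i < j" "(T ^^ i) x = (T ^^ j) x"
    using linorder_inj_onI'[of "{..card F}" "\<lambda>i. (T ^^ i) x"] by blast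
  define p :: "'k poly" where "p = monom 1 j - monom 1 i"
  have c: "coeff p l = (if l = j then 1 else 0) - (if l = i then 1 else 0)" for l
    by (auto simp: p_def)
  have "degree p \<le> j" using ij by (intro degree_le) (simp add: c)
  then have "poly_op p x = (\<Sum>l\<le>j. coeff p l *s (T ^^ l) x)" by (rule poly_op_bound)
  also have "\<dots> = (\<Sum>l\<le>j. (if l = j then (T ^^ l) x else 0) - (if l = i then (T ^^ l) x else 0))"
    by (intro sum.cong) (auto simp: c)
  also have "\<dots> = 0" using ij by (simp add: sum_subtractf)
  finally have "poly_op p x = 0" .
  moreover have "p \<noteq> 0" using c[of j] ij by auto
  ultimately show ?thesis by blast
qed

text \<open>
  A polynomial of minimal degree with \<open>p(T) x = 0\<close> has a non-zero constant coefficient: otherwise \<open>T\<close>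
  could be cancelled from \<open>p(T) x = T (q(T) x)\<close>.  Solving \<open>p(T) x = 0\<close> for \<open>x\<close> then exhibits \<open>x\<close> as a
  value of \<open>T\<close>.
\<close>

lemma injective_imp_surjective:
  assumes inj: "\<And>x. x \<in> U \<Longrightarrow> T x = 0 \<Longrightarrow> x = 0" and x: "x \<in> U"
  obtains y where "y \<in> U" "T y = x"
proof -
  let ?P = "\<lambda>p. p \<noteq> 0 \<and> poly_op p x = 0"
  obtain p where p: "?P p" and min: "\<And>q. ?P q \<Longrightarrow> degree p \<le> degree q"
    using ex_annihilating_poly[OF x] ex_has_least_nat[of ?P _ degree] by metis
  have "coeff p 0 \<noteq> 0"
  proof
    assume "coeff p 0 = 0"
    then have "poly p 0 = 0" by (simp add: poly_0_coeff_0)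
    then obtain q where q: "p = [:- 0, 1:] * q" by (metis poly_eq_0_iff_dvd dvdE)
    then have "T (poly_op q x) = 0" using p poly_op_linear_factor[OF x, of 0 q] by simp
    then have "poly_op q x = 0" using inj poly_op_in x by blast
    moreover have "q \<noteq> 0" using p q by auto
    ultimately have "degree p \<le> degree q" using min by blast
    moreover have "degree p = Suc (degree q)" unfolding q using \<open>q \<noteq> 0\<close> by (subst degree_mult_eq) auto
    ultimately show False by simp
  qed
  define n where "n = degree p"
  define s where "s = (\<Sum>i<n. coeff p (Suc i) *s (T ^^ i) x)"
  have s: "s \<in> U" unfolding s_def using x by (intro subspace_sum subspace_U) auto
  have "T s = (\<Sum>i<n. coeff p (Suc i) *s (T ^^ Suc i) x)"
    unfolding s_def using x by (subst T_sum) (auto simp: T_scale)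
  moreover have "poly_op p x = coeff p 0 *s x + (\<Sum>i<n. coeff p (Suc i) *s (T ^^ Suc i) x)"
    unfolding poly_op_def n_def by (subst sum.atMost_shift) simp
  ultimately have "coeff p 0 *s x + T s = 0" using p by metis
  then have "T s = - (coeff p 0 *s x)" by (simp add: eq_neg_iff_add_eq_0 add.commute)
  then have "T ((- inverse (coeff p 0)) *s s) = (- inverse (coeff p 0)) *s (- (coeff p 0 *s x))"
    using s by (simp only: T_scale)
  also have "\<dots> = x" using \<open>coeff p 0 \<noteq> 0\<close> by simp
  finally show thesis using that s U_simps(4) by blast
qed

text \<open>
  Eigenvectors in the quotient \<open>U / W\<close>, without forming the quotient: if \<open>p\<close> has minimal degree with
  \<open>p(T) x \<in> W\<close> and \<open>p = (t - \<mu>) q\<close>, then \<open>q(T) x\<close> is an eigenvector modulo \<open>W\<close>.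
\<close>

lemma eigenvector_modulo:
  assumes W: "subspace W" and x: "x \<in> U" "x \<notin> W"
  shows "\<exists>y \<mu>. y \<in> U \<and> y \<notin> W \<and> T y - \<mu> *s y \<in> W"
proof -
  let ?P = "\<lambda>p. p \<noteq> 0 \<and> poly_op p x \<in> W"
  obtain p where p: "?P p" and min: "\<And>q. ?P q \<Longrightarrow> degree p \<le> degree q"
    using ex_annihilating_poly[OF x(1)] subspace_0[OF W] ex_has_least_nat[of ?P _ degree] by metis
  have "degree p \<noteq> 0"
  proof
    assume "degree p = 0"
    then obtain a where a: "p = [:a:]" by (meson degree_eq_zeroE)
    then have "a \<noteq> 0" "a *s x \<in> W" using p by (auto simp: poly_op_def)
    then have "inverse a *s (a *s x) \<in> W" using subspace_scale[OF W] by blast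
    then show False using x \<open>a \<noteq> 0\<close> by simp
  qed
  then obtain \<mu> where "poly p \<mu> = 0" using alg_closed_imp_poly_has_root by blast
  then obtain q where q: "p = [:- \<mu>, 1:] * q" by (metis poly_eq_0_iff_dvd dvdE)
  then have "q \<noteq> 0" using p by auto
  then have "degree p = Suc (degree q)" unfolding q by (subst degree_mult_eq) auto
  then have "poly_op q x \<notin> W" using min[of q] \<open>q \<noteq> 0\<close> by auto
  then show ?thesis using p poly_op_linear_factor[OF x(1), of \<mu> q] poly_op_in[OF x(1)] q by metis
qed

text \<open>
  The vectors killed by some power of \<open>T - \<mu>\<close>.  The inductive form replaces binomial expansions of
  these powers by inductions over one application of \<open>T - \<mu>\<close>.
\<close>

inductive gen_eigenvector :: "'k \<Rightarrow> 'v \<Rightarrow> bool" where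
  zero: "gen_eigenvector \<mu> 0"
| step: "x \<in> U \<Longrightarrow> gen_eigenvector \<mu> (T x - \<mu> *s x) \<Longrightarrow> gen_eigenvector \<mu> x"

lemma gen_eigenvector_in: "gen_eigenvector \<mu> x \<Longrightarrow> x \<in> U"
  by (induction rule: gen_eigenvector.induct) auto

lemma gen_eigenvector_T: "gen_eigenvector \<mu> x \<Longrightarrow> gen_eigenvector \<mu> (T x - \<mu> *s x)"
  by (erule gen_eigenvector.cases) (auto intro: gen_eigenvector.zero)

lemma gen_eigenvector_add:
  "gen_eigenvector \<mu> x \<Longrightarrow> gen_eigenvector \<mu> y \<Longrightarrow> gen_eigenvector \<mu> (x + y)"
proof (induction arbitrary: y rule: gen_eigenvector.induct)
  case (step x \<mu>)
  have "gen_eigenvector \<mu> (T x - \<mu> *s x + (T y - \<mu> *s y))"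
    by (rule step.IH[OF gen_eigenvector_T[OF step.prems]])
  then show ?case using step.hyps(1) gen_eigenvector_in[OF step.prems]
    by - (rule gen_eigenvector.step, auto simp: T_add algebra_simps)
qed auto

lemma gen_eigenvector_scale: "gen_eigenvector \<mu> x \<Longrightarrow> gen_eigenvector \<mu> (c *s x)"
proof (induction rule: gen_eigenvector.induct)
  case (step x \<mu>)
  then show ?case
    by - (rule gen_eigenvector.step, auto simp: T_scale scale_right_diff_distrib mult.commute)
qed (auto intro: gen_eigenvector.zero)

text \<open>
  The operator \<open>T - \<mu> = (T - \<nu>) + (\<nu> - \<mu>)\<close> is a nilpotent plus a non-zero scalar on the generalized
  eigenspace of \<open>\<nu>\<close>, hence surjective there.
\<close>

lemma gen_eigenvector_solve:
  assumes "gen_eigenvector \<nu> z" "\<nu> \<noteq> \<mu>"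
  shows "\<exists>y. gen_eigenvector \<nu> y \<and> T y - \<mu> *s y = z"
  using assms
proof (induction rule: gen_eigenvector.induct)
  case (zero \<nu>)
  then show ?case by (intro exI[of _ 0]) (auto intro: gen_eigenvector.zero)
next
  case (step z \<nu>)
  then obtain y where y: "gen_eigenvector \<nu> y" "T y - \<mu> *s y = T z - \<nu> *s z" by blast
  have z: "gen_eigenvector \<nu> z" using step gen_eigenvector.step by blast
  let ?y = "inverse (\<nu> - \<mu>) *s (z + (-1) *s y)"
  have "T ?y - \<mu> *s ?y = inverse (\<nu> - \<mu>) *s ((T z - \<nu> *s z) + (\<nu> - \<mu>) *s z - (T y - \<mu> *s y))"
    using step.hyps(1) gen_eigenvector_in[OF y(1)] by (simp add: T_scale T_add T_diff algebra_simps)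
  also have "\<dots> = inverse (\<nu> - \<mu>) *s ((\<nu> - \<mu>) *s z)" unfolding y(2) by simp
  also have "\<dots> = z" using step.prems by simp
  finally show ?case using y(1) z gen_eigenvector_add gen_eigenvector_scale by blast
qed

text \<open>
  Let \<open>Z\<close> be the span of the generalized eigenvectors.  If it were proper, there would be an eigenvector
  \<open>x\<close> modulo \<open>Z\<close>, say \<open>(T - \<mu>) x = z \<in> Z\<close>.  The components of \<open>z\<close> belonging to other
  eigenvalues are in the image of \<open>T - \<mu>\<close> on \<open>Z\<close>, so \<open>x\<close> can be corrected by some \<open>y \<in> Z\<close> until \<open>z\<close> is a
  generalized eigenvector for \<open>\<mu>\<close>; but then so is \<open>x - y\<close>, whence \<open>x \<in> Z\<close>.
\<close>

lemma gen_eigenvectors_span: "U \<subseteq> span {x. \<exists>\<mu>. gen_eigenvector \<mu> x}" (is "U \<subseteq> span ?G")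
proof (rule ccontr)
  assume "\<not> U \<subseteq> span ?G"
  then obtain x \<mu> where x: "x \<in> U" "x \<notin> span ?G" "T x - \<mu> *s x \<in> span ?G"
    using eigenvector_modulo[OF subspace_span] by blast
  have GU: "y \<in> U" if "y \<in> span ?G" for y
    using that span_minimal[of ?G U] subspace_U gen_eigenvector_in by auto
  have "\<exists>y\<in>span ?G. gen_eigenvector \<mu> (z - (T y - \<mu> *s y))" if "z \<in> span ?G" for z
    using that
  proof (induction rule: span_induct_alt)
    case base
    show ?case by (intro bexI[of _ 0]) (auto intro: gen_eigenvector.zero span_zero)
  next
    case (step c z z')
    then obtain \<nu> y' where \<nu>: "gen_eigenvector \<nu> z"
      and y': "y' \<in> span ?G" "gen_eigenvector \<mu> (z' - (T y' - \<mu> *s y'))" by blast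
    have "\<exists>y\<in>span ?G. gen_eigenvector \<mu> (z - (T y - \<mu> *s y))"
    proof (cases "\<nu> = \<mu>")
      case True
      with \<nu> show ?thesis by (intro bexI[of _ 0]) (auto intro: span_zero)
    next
      case False
      with \<nu> obtain y where "gen_eigenvector \<nu> y" "T y - \<mu> *s y = z"
        using gen_eigenvector_solve by blast
      then show ?thesis by (intro bexI[of _ y]) (auto intro: gen_eigenvector.zero span_base)
    qed
    then obtain y where y: "y \<in> span ?G" "gen_eigenvector \<mu> (z - (T y - \<mu> *s y))" by blast
    have "gen_eigenvector \<mu> (c *s (z - (T y - \<mu> *s y)) + (z' - (T y' - \<mu> *s y')))"
      by (rule gen_eigenvector_add[OF gen_eigenvector_scale[OF y(2)] y'(2)])
    also have "c *s (z - (T y - \<mu> *s y)) + (z' - (T y' - \<mu> *s y'))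
      = c *s z + z' - (T (c *s y + y') - \<mu> *s (c *s y + y'))"
      using GU[OF y(1)] GU[OF y'(1)] by (simp add: T_add T_scale algebra_simps)
    finally show ?case using span_add[OF span_scale[OF y(1)] y'(1)] by (rule rev_bexI[rotated])
  qed
  then obtain y where y: "y \<in> span ?G" "gen_eigenvector \<mu> (T x - \<mu> *s x - (T y - \<mu> *s y))"
    using x(3) by blast
  have "gen_eigenvector \<mu> (x - y)"
    using x(1) y(2) GU[OF y(1)] by - (rule gen_eigenvector.step, auto simp: T_diff algebra_simps)
  then have "x - y \<in> span ?G" by (auto intro: span_base)
  from span_add[OF this y(1)] x(2) show False by simp
qed

definition eigenvalues :: "'k set" where
  "eigenvalues = {\<mu>. \<exists>x\<in>U. x \<noteq> 0 \<and> T x = \<mu> *s x}"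

lemma gen_eigenvector_eigenvalue: "gen_eigenvector \<mu> x \<Longrightarrow> x \<noteq> 0 \<Longrightarrow> \<mu> \<in> eigenvalues"
proof (induction rule: gen_eigenvector.induct)
  case (step x \<mu>)
  then show ?case by (cases "T x = \<mu> *s x") (auto simp: eigenvalues_def)
qed auto

lemma eigenvectors_sum_0:
  assumes "finite A" "\<And>\<mu>. \<mu> \<in> A \<Longrightarrow> x \<mu> \<in> U \<and> T (x \<mu>) = \<mu> *s x \<mu>" "(\<Sum>\<mu>\<in>A. x \<mu>) = 0" "\<mu> \<in> A"
  shows "x \<mu> = 0"
  using assms
proof (induction A arbitrary: x \<mu> rule: finite_induct)
  case (insert \<nu> A)
  have S: "sum x A \<in> U" using insert.prems(1) by (intro subspace_sum subspace_U) auto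
  have "0 = T (x \<nu> + sum x A) - \<nu> *s (x \<nu> + sum x A)"
    using insert.prems(2) insert.hyps by simp
  also have "\<dots> = T (sum x A) - \<nu> *s sum x A"
    using insert.prems(1) S by (simp add: T_add algebra_simps)
  also have "T (sum x A) = (\<Sum>\<mu>\<in>A. \<mu> *s x \<mu>)"
    using insert.prems(1) by (subst T_sum) auto
  finally have "(\<Sum>\<mu>\<in>A. (\<mu> - \<nu>) *s x \<mu>) = 0"
    by (simp only: scale_sum_right scale_left_diff_distrib sum_subtractf)
  then have "(\<mu> - \<nu>) *s x \<mu> = 0" if "\<mu> \<in> A" for \<mu>
    using insert.IH[of "\<lambda>\<mu>. (\<mu> - \<nu>) *s x \<mu>" \<mu>] insert.prems(1) that by (auto simp: T_scale mult.commute)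
  then have A: "x \<mu> = 0" if "\<mu> \<in> A" for \<mu> using that insert.hyps by fastforce
  then have "x \<nu> = 0" using insert.prems(2) insert.hyps by simp
  then show ?case using A insert.prems(3) by auto
qed auto

text \<open>
  Eigenvectors for distinct eigenvalues are linearly independent.
\<close>

lemma finite_eigenvalues: "finite eigenvalues"
proof -
  have "\<forall>\<mu>\<in>eigenvalues. \<exists>x. x \<in> U \<and> x \<noteq> 0 \<and> T x = \<mu> *s x"
    by (auto simp: eigenvalues_def)
  from bchoice[OF this] obtain x
    where "\<forall>\<mu>\<in>eigenvalues. x \<mu> \<in> U \<and> x \<mu> \<noteq> 0 \<and> T (x \<mu>) = \<mu> *s x \<mu>" ..
  then have x: "x \<mu> \<in> U" "x \<mu> \<noteq> 0" "T (x \<mu>) = \<mu> *s x \<mu>" if "\<mu> \<in> eigenvalues" for \<mu>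
    using that by auto
  have inj: "inj_on x eigenvalues"
  proof (rule inj_onI)
    fix \<mu> \<nu> assume h: "\<mu> \<in> eigenvalues" "\<nu> \<in> eigenvalues" "x \<mu> = x \<nu>"
    have "\<mu> *s x \<mu> = \<nu> *s x \<mu>" using x(3)[OF h(1)] x(3)[OF h(2)] h(3) by metis
    then show "\<mu> = \<nu>" using x(2)[OF h(1)] by simp
  qed
  have "independent (x ` eigenvalues)"
    unfolding independent_explicit_module
  proof (intro allI impI)
    fix B u v
    assume B: "finite B" "B \<subseteq> x ` eigenvalues" "(\<Sum>v\<in>B. u v *s v) = 0" "v \<in> B"
    then obtain A where A: "A \<subseteq> eigenvalues" "B = x ` A" by (meson subset_image_iff)
    have injA: "inj_on x A" using inj A(1) inj_on_subset by blast
    have fin: "finite A" using B(1) A(2) injA finite_imageD by blast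
    obtain \<mu> where \<mu>: "\<mu> \<in> A" "v = x \<mu>" using B(4) A(2) by auto
    have "(\<Sum>\<mu>\<in>A. u (x \<mu>) *s x \<mu>) = 0" using B(3) unfolding A(2) by (simp add: sum.reindex[OF injA])
    moreover have "u (x \<kappa>) *s x \<kappa> \<in> U \<and> T (u (x \<kappa>) *s x \<kappa>) = \<kappa> *s (u (x \<kappa>) *s x \<kappa>)"
      if "\<kappa> \<in> A" for \<kappa>
      using that A(1) x by (auto simp: T_scale mult.commute)
    ultimately have "u (x \<mu>) *s x \<mu> = 0"
      using eigenvectors_sum_0[OF fin, of "\<lambda>\<mu>. u (x \<mu>) *s x \<mu>"] \<mu>(1) by blast
    then show "u v = 0" using \<mu> x(2) A(1) by auto
  qed
  moreover have "x ` eigenvalues \<subseteq> span F" using x(1) U_le by blast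
  ultimately have "finite (x ` eigenvalues)" using independent_span_bound[OF finite_F] by blast
  then show ?thesis using inj finite_imageD by blast
qed

end

section \<open>Elementary calculus in a Lie superalgebra\<close>

lemma signed_0 [simp]: "signed 0 x = x"
  and signed_1 [simp]: "signed 1 x = - x"
  by (simp_all add: signed_def)

lemma bit_cases: "(d :: bit) = 0 \<or> d = 1"
  by (cases d) auto

sublocale lie_superalgebra \<subseteq> vector_space "smul L"
  by (rule vector_space)

context lie_superalgebra
begin

abbreviation carrier ("V") where "V \<equiv> supercarrier L"
abbreviation br ("\<lbrakk>_, _\<rbrakk>") where "\<lbrakk>x, y\<rbrakk> \<equiv> bracket L x y"
abbreviation scale (infixr "*s" 75) where "c *s x \<equiv> smul L c x"

lemma part_simps [simp, intro]:
  "0 \<in> part L i" "x \<in> part L i \<Longrightarrow> y \<in> part L i \<Longrightarrow> x + y \<in> part L i"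
  "x \<in> part L i \<Longrightarrow> y \<in> part L i \<Longrightarrow> x - y \<in> part L i" "x \<in> part L i \<Longrightarrow> - x \<in> part L i"
  "x \<in> part L i \<Longrightarrow> c *s x \<in> part L i"
  using subspace by (auto intro: subspace_0 subspace_add subspace_diff subspace_neg subspace_scale)

lemma part_in_carrier: "x \<in> part L i \<Longrightarrow> x \<in> V"
  using bit_cases[of i] unfolding supercarrier_def by force

lemma carrier_cases:
  assumes "x \<in> V"
  obtains y z where "x = y + z" "y \<in> part L 0" "z \<in> part L 1"
  using assms unfolding supercarrier_def by blast

lemma subspace_carrier: "subspace V"
  unfolding supercarrier_def by (rule subspace_sums[OF subspace subspace])

lemma carrier_simps [simp, intro]:
  "0 \<in> V" "x \<in> V \<Longrightarrow> y \<in> V \<Longrightarrow> x + y \<in> V" "x \<in> V \<Longrightarrow> y \<in> V \<Longrightarrow> x - y \<in> V"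
  "x \<in> V \<Longrightarrow> - x \<in> V" "x \<in> V \<Longrightarrow> c *s x \<in> V"
  using subspace_carrier
  by (auto intro: subspace_0 subspace_add subspace_diff subspace_neg subspace_scale)

lemma signed_part [simp]: "x \<in> part L i \<Longrightarrow> signed d x \<in> part L i"
  and signed_carrier [simp]: "x \<in> V \<Longrightarrow> signed d x \<in> V"
  by (auto simp: signed_def)

text \<open>
  One fixed finite spanning set serves as the dimension witness for every subspace of the carrier.
\<close>

definition spanning_set :: "'v set" where
  "spanning_set = (SOME S. finite S \<and> V = span S)"

lemma spanning_set: "finite spanning_set" "V = span spanning_set"
  using someI_ex[OF finite_dim] by (simp_all add: spanning_set_def)

lemma scale_two: "2 *s x = x + x"
  by (metis one_add_one scale_left_distrib scale_one)

text \<open>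
  Identities whose signs depend on parities are stated for homogeneous vectors only; this lemma extends
  them to all vectors when both sides are additive.
\<close>

lemma linear_eq_by_parts:
  assumes x: "x \<in> V"
    and hom: "\<And>i u. u \<in> part L i \<Longrightarrow> f u = h u"
    and f: "\<And>u v. u \<in> V \<Longrightarrow> v \<in> V \<Longrightarrow> f (u + v) = f u + f v"
    and h: "\<And>u v. u \<in> V \<Longrightarrow> v \<in> V \<Longrightarrow> h (u + v) = h u + (h v :: 'a :: plus)"
  shows "f x = h x"
proof -
  obtain u v where x: "x = u + v" and p: "u \<in> part L 0" "v \<in> part L 1"
    using x by (rule carrier_cases)
  then have "u \<in> V" "v \<in> V" using part_in_carrier by blast+
  then show ?thesis unfolding x by (simp only: f h hom[OF p(1)] hom[OF p(2)])
qed

lemma br_add_left: "x \<in> V \<Longrightarrow> y \<in> V \<Longrightarrow> z \<in> V \<Longrightarrow> \<lbrakk>x + y, z\<rbrakk> = \<lbrakk>x, z\<rbrakk> + \<lbrakk>y, z\<rbrakk>"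
  and br_add_right: "x \<in> V \<Longrightarrow> y \<in> V \<Longrightarrow> z \<in> V \<Longrightarrow> \<lbrakk>z, x + y\<rbrakk> = \<lbrakk>z, x\<rbrakk> + \<lbrakk>z, y\<rbrakk>"
  and br_scale_left: "x \<in> V \<Longrightarrow> z \<in> V \<Longrightarrow> \<lbrakk>c *s x, z\<rbrakk> = c *s \<lbrakk>x, z\<rbrakk>"
  and br_scale_right: "x \<in> V \<Longrightarrow> z \<in> V \<Longrightarrow> \<lbrakk>z, c *s x\<rbrakk> = c *s \<lbrakk>z, x\<rbrakk>"
  using bilinear unfolding bilinear_on_def linear_on_def by blast+

lemma br_0_left [simp]: "z \<in> V \<Longrightarrow> \<lbrakk>0, z\<rbrakk> = 0"
  and br_0_right [simp]: "z \<in> V \<Longrightarrow> \<lbrakk>z, 0\<rbrakk> = 0"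
  using br_scale_left[of 0 z 0] br_scale_right[of 0 z 0] by simp_all

lemma br_minus_left: "x \<in> V \<Longrightarrow> z \<in> V \<Longrightarrow> \<lbrakk>- x, z\<rbrakk> = - \<lbrakk>x, z\<rbrakk>"
  and br_minus_right: "x \<in> V \<Longrightarrow> z \<in> V \<Longrightarrow> \<lbrakk>z, - x\<rbrakk> = - \<lbrakk>z, x\<rbrakk>"
  using br_scale_left[of x z "- 1"] br_scale_right[of x z "- 1"] by simp_all

lemma br_diff_left: "x \<in> V \<Longrightarrow> y \<in> V \<Longrightarrow> z \<in> V \<Longrightarrow> \<lbrakk>x - y, z\<rbrakk> = \<lbrakk>x, z\<rbrakk> - \<lbrakk>y, z\<rbrakk>"
  and br_diff_right: "x \<in> V \<Longrightarrow> y \<in> V \<Longrightarrow> z \<in> V \<Longrightarrow> \<lbrakk>z, x - y\<rbrakk> = \<lbrakk>z, x\<rbrakk> - \<lbrakk>z, y\<rbrakk>"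
  using br_add_left[of x "- y" z] br_add_right[of x "- y" z]
  by (simp_all add: br_minus_left br_minus_right)

lemma br_in [simp]:
  assumes "x \<in> V" "y \<in> V"
  shows "\<lbrakk>x, y\<rbrakk> \<in> V"
proof -
  from assms obtain a b c d where e: "x = a + b" "y = c + d" and
    p: "a \<in> part L 0" "b \<in> part L 1" "c \<in> part L 0" "d \<in> part L 1"
    by (meson carrier_cases)
  then have m: "a \<in> V" "b \<in> V" "c \<in> V" "d \<in> V" by (auto intro: part_in_carrier)
  have "\<lbrakk>a, c\<rbrakk> \<in> V" "\<lbrakk>a, d\<rbrakk> \<in> V" "\<lbrakk>b, c\<rbrakk> \<in> V" "\<lbrakk>b, d\<rbrakk> \<in> V"
    by (rule part_in_carrier degree p)+
  then show ?thesis unfolding e using m by (simp add: br_add_left br_add_right)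
qed

lemma br_span_left:
  assumes "x \<in> span X" "X \<subseteq> V" "subspace W" "z \<in> V" "\<And>x. x \<in> X \<Longrightarrow> \<lbrakk>x, z\<rbrakk> \<in> W"
  shows "\<lbrakk>x, z\<rbrakk> \<in> W"
proof -
  have "x \<in> V \<and> \<lbrakk>x, z\<rbrakk> \<in> W"
    using assms(1)
  proof (induction rule: span_induct_alt)
    case base
    then show ?case using assms by (auto intro: subspace_0)
  next
    case (step c x y)
    then show ?case using assms
      by (auto simp: br_add_left br_scale_left subset_iff intro!: subspace_add subspace_scale)
  qed
  then show ?thesis ..
qed

lemma br_span_right:
  assumes "x \<in> span X" "X \<subseteq> V" "subspace W" "z \<in> V" "\<And>x. x \<in> X \<Longrightarrow> \<lbrakk>z, x\<rbrakk> \<in> W"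
  shows "\<lbrakk>z, x\<rbrakk> \<in> W"
proof -
  have "x \<in> V \<and> \<lbrakk>z, x\<rbrakk> \<in> W"
    using assms(1)
  proof (induction rule: span_induct_alt)
    case base
    then show ?case using assms by (auto intro: subspace_0)
  next
    case (step c x y)
    then show ?case using assms
      by (auto simp: br_add_right br_scale_right subset_iff intro!: subspace_add subspace_scale)
  qed
  then show ?thesis ..
qed

lemma br_span:
  assumes "x \<in> span X" "y \<in> span X" "X \<subseteq> V" "subspace W"
    and "\<And>x y. x \<in> X \<Longrightarrow> y \<in> X \<Longrightarrow> \<lbrakk>x, y\<rbrakk> \<in> W"
  shows "\<lbrakk>x, y\<rbrakk> \<in> W"
proof (rule br_span_left[OF assms(1,3,4)])
  show "y \<in> V" using assms(2,3) span_minimal[OF _ subspace_carrier] by blast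
  show "\<lbrakk>x, y\<rbrakk> \<in> W" if "x \<in> X" for x
    using that assms by (intro br_span_right[OF assms(2,3,4)]) auto
qed

text \<open>
  The Jacobi identity in the form "the adjoint action of \<open>x\<close> is a superderivation", in which it is used
  throughout.
\<close>

lemma leibniz_homogeneous:
  assumes x: "x \<in> part L a" and y: "y \<in> part L b" and z: "z \<in> part L c"
  shows "\<lbrakk>x, \<lbrakk>y, z\<rbrakk>\<rbrakk> = \<lbrakk>\<lbrakk>x, y\<rbrakk>, z\<rbrakk> + signed (a * b) \<lbrakk>y, \<lbrakk>x, z\<rbrakk>\<rbrakk>"
proof -
  have m: "x \<in> V" "y \<in> V" "z \<in> V" using assms part_in_carrier by blast+
  note j = jacobi[OF x y z] skew[OF z x] skew[OF z degree[OF x y]]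
  show ?thesis
    using bit_cases[of a] bit_cases[of b] bit_cases[of c] j m
    by (elim disjE) (simp_all add: br_minus_right eq_neg_iff_add_eq_0 algebra_simps)
qed

lemma leibniz:
  assumes x: "x \<in> part L a" and y: "y \<in> part L b" and z: "z \<in> V"
  shows "\<lbrakk>x, \<lbrakk>y, z\<rbrakk>\<rbrakk> = \<lbrakk>\<lbrakk>x, y\<rbrakk>, z\<rbrakk> + signed (a * b) \<lbrakk>y, \<lbrakk>x, z\<rbrakk>\<rbrakk>"
proof -
  from z obtain u v where e: "z = u + v" and p: "u \<in> part L 0" "v \<in> part L 1"
    by (rule carrier_cases)
  have m: "x \<in> V" "y \<in> V" "u \<in> V" "v \<in> V" using x y p part_in_carrier by blast+
  show ?thesis
    unfolding e using m leibniz_homogeneous[OF x y p(1)] leibniz_homogeneous[OF x y p(2)]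
    by (simp add: br_add_right signed_def)
qed

end

section \<open>Engel's theorem for sets of homogeneous elements\<close>

context lie_superalgebra
begin

text \<open>
  The conclusion of Engel's theorem for the action of \<open>K\<close> on all subquotients at once: whenever the
  \<open>K\<close>-stable set \<open>A\<close> is not contained in the \<open>K\<close>-stable subspace \<open>W\<close>, some element of \<open>A\<close> is non-zero
  modulo \<open>W\<close> and is killed by \<open>K\<close> modulo \<open>W\<close>.  Taking \<open>A\<close> to be a set, instead of a subspace, keeps the
  element found in \<open>S\<close>, whose members act nilpotently.
\<close>

definition acts_nilpotently :: "'v set \<Rightarrow> 'v set \<Rightarrow> bool" where
  "acts_nilpotently S K \<longleftrightarrow>
     (\<forall>W A. subspace W \<and> A \<subseteq> S \<and> \<not> A \<subseteq> W \<and>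
        (\<forall>u\<in>K. \<forall>w\<in>W \<inter> V. \<lbrakk>u, w\<rbrakk> \<in> W) \<and> (\<forall>u\<in>K. \<forall>a\<in>A. \<lbrakk>u, a\<rbrakk> \<in> A) \<longrightarrow>
        (\<exists>a\<in>A - W. \<forall>u\<in>K. \<lbrakk>u, a\<rbrakk> \<in> W))"

lemma acts_nilpotentlyD:
  assumes "acts_nilpotently S K" "subspace W" "A \<subseteq> S" "\<not> A \<subseteq> W"
    "\<And>u w. u \<in> K \<Longrightarrow> w \<in> W \<Longrightarrow> w \<in> V \<Longrightarrow> \<lbrakk>u, w\<rbrakk> \<in> W" "\<And>u a. u \<in> K \<Longrightarrow> a \<in> A \<Longrightarrow> \<lbrakk>u, a\<rbrakk> \<in> A"
  obtains a where "a \<in> A" "a \<notin> W" "\<And>u. u \<in> K \<Longrightarrow> \<lbrakk>u, a\<rbrakk> \<in> W"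
proof -
  have "\<exists>a\<in>A - W. \<forall>u\<in>K. \<lbrakk>u, a\<rbrakk> \<in> W"
    using assms unfolding acts_nilpotently_def by simp
  then show thesis using that by blast
qed

lemma nilpotent_last_outside:
  assumes "(bracket L v ^^ n) a \<in> W" "a \<in> A" "a \<notin> W" "\<And>a. a \<in> A \<Longrightarrow> \<lbrakk>v, a\<rbrakk> \<in> A"
  shows "\<exists>b\<in>A - W. \<lbrakk>v, b\<rbrakk> \<in> W"
  using assms(1-3)
proof (induction n arbitrary: a)
  case (Suc n)
  show ?case
  proof (cases "\<lbrakk>v, a\<rbrakk> \<in> W")
    case False
    have "(bracket L v ^^ n) \<lbrakk>v, a\<rbrakk> \<in> W" using Suc.prems(1) by (simp add: funpow_swap1)
    then show ?thesis using Suc.IH[OF _ assms(4)[OF Suc.prems(2)] False] by blast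
  qed (use Suc.prems in blast)
qed auto

text \<open>
  Let \<open>A'\<close> be the part of \<open>A\<close> that \<open>K\<close> kills modulo \<open>W\<close>.  As \<open>v\<close> normalizes \<open>K\<close>, it maps \<open>A'\<close> into itself;
  as it acts nilpotently, the last iterate that is outside \<open>W\<close> is killed by \<open>v\<close> as well.
\<close>

lemma acts_nilpotently_insert:
  assumes S: "S \<subseteq> part L 0 \<union> part L 1"
    and closed: "\<And>x y. x \<in> S \<Longrightarrow> y \<in> S \<Longrightarrow> \<lbrakk>x, y\<rbrakk> \<in> S"
    and nilpotent: "\<And>x y. x \<in> S \<Longrightarrow> y \<in> S \<Longrightarrow> \<exists>n. (bracket L x ^^ n) y = 0"
    and B: "B \<subseteq> S" and K: "acts_nilpotently S (S \<inter> span B)"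
    and v: "v \<in> S" "\<And>u. u \<in> S \<inter> span B \<Longrightarrow> \<lbrakk>u, v\<rbrakk> \<in> span B"
  shows "acts_nilpotently S (S \<inter> span (insert v B))"
  unfolding acts_nilpotently_def
proof (intro allI impI, elim conjE)
  fix W A
  assume W: "subspace W" and A: "A \<subseteq> S" "\<not> A \<subseteq> W"
    and stable: "\<forall>u\<in>S \<inter> span (insert v B). \<forall>w\<in>W \<inter> V. \<lbrakk>u, w\<rbrakk> \<in> W"
      "\<forall>u\<in>S \<inter> span (insert v B). \<forall>a\<in>A. \<lbrakk>u, a\<rbrakk> \<in> A"
  have SV: "S \<subseteq> V" using S part_in_carrier by blast
  have K_le: "S \<inter> span B \<subseteq> S \<inter> span (insert v B)" using span_mono[of B "insert v B"] by blast
  have v': "v \<in> S \<inter> span (insert v B)" using v(1) span_base by blast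
  define A' where "A' = {a \<in> A. \<forall>u\<in>S \<inter> span B. \<lbrakk>u, a\<rbrakk> \<in> W}"
  obtain a where a: "a \<in> A'" "a \<notin> W"
    using acts_nilpotentlyD[OF K W A] stable K_le unfolding A'_def
    by (smt (verit, best) IntI mem_Collect_eq subset_iff)
  have A'_stable: "\<lbrakk>v, a\<rbrakk> \<in> A'" if a: "a \<in> A'" for a
  proof -
    have aA: "a \<in> A" using a by (simp add: A'_def)
    have "\<lbrakk>u, \<lbrakk>v, a\<rbrakk>\<rbrakk> \<in> W" if u: "u \<in> S \<inter> span B" for u
    proof -
      obtain i j where ij: "u \<in> part L i" "v \<in> part L j" using u v(1) S by blast
      have "\<lbrakk>u, v\<rbrakk> \<in> S \<inter> span B" using closed u v by blast
      then have "\<lbrakk>\<lbrakk>u, v\<rbrakk>, a\<rbrakk> \<in> W" using a by (simp add: A'_def)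
      moreover have "\<lbrakk>v, \<lbrakk>u, a\<rbrakk>\<rbrakk> \<in> W"
      proof -
        have "u \<in> V" "a \<in> V" using u aA A(1) SV by blast+
        then have "\<lbrakk>u, a\<rbrakk> \<in> W \<inter> V" using a u by (simp add: A'_def)
        then show ?thesis using stable(1) v' by blast
      qed
      moreover have "a \<in> V" using aA A(1) SV by blast
      ultimately show ?thesis
        using leibniz[OF ij, of a] by (simp add: signed_def subspace_add[OF W] subspace_diff[OF W])
    qed
    then show ?thesis using stable(2) v' aA by (simp add: A'_def)
  qed
  obtain n where "(bracket L v ^^ n) a = 0" using nilpotent[OF v(1), of a] a(1) A(1) unfolding A'_def by blast
  then have "(bracket L v ^^ n) a \<in> W" using subspace_0[OF W] by simp
  then obtain b where b: "b \<in> A'" "b \<notin> W" "\<lbrakk>v, b\<rbrakk> \<in> W"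
    using nilpotent_last_outside a A'_stable by blast
  have "\<lbrakk>u, b\<rbrakk> \<in> W" if "u \<in> S \<inter> span (insert v B)" for u
  proof (rule br_span_left[of u "insert v B"])
    show "insert v B \<subseteq> V" "b \<in> V" using B v(1) SV b(1) A(1) by (auto simp: A'_def)
    show "\<lbrakk>x, b\<rbrakk> \<in> W" if "x \<in> insert v B" for x
      using that b B by (auto simp: A'_def intro: span_base)
  qed (use that W in auto)
  then show "\<exists>a\<in>A - W. \<forall>u\<in>S \<inter> span (insert v B). \<lbrakk>u, a\<rbrakk> \<in> W"
    using b by (auto simp: A'_def)
qed

text \<open>
  The hypothesis on \<open>K\<close>, applied to its action on the algebra modulo the span of \<open>B\<close>, gives
  \<open>v \<in> S\<close> outside that span which normalizes it.  For \<open>v\<close> to enlarge the subalgebra by one dimension,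
  \<open>[v, v]\<close> must lie in the span.  If it does not, then \<open>v\<close> is odd, and the even vector \<open>[v, v]\<close>, which
  still normalizes the span and commutes with itself, replaces it.
\<close>

lemma engel_extension:
  assumes S: "S \<subseteq> part L 0 \<union> part L 1"
    and closed: "\<And>x y. x \<in> S \<Longrightarrow> y \<in> S \<Longrightarrow> \<lbrakk>x, y\<rbrakk> \<in> S"
    and B: "B \<subseteq> S" "\<And>x y. x \<in> B \<Longrightarrow> y \<in> B \<Longrightarrow> \<lbrakk>x, y\<rbrakk> \<in> span B"
    and K: "acts_nilpotently S (S \<inter> span B)" and "\<not> S \<subseteq> span B"
  obtains v where "v \<in> S" "v \<notin> span B" "\<And>u. u \<in> S \<inter> span B \<Longrightarrow> \<lbrakk>u, v\<rbrakk> \<in> span B" "\<lbrakk>v, v\<rbrakk> \<in> span B"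
proof -
  have SV: "S \<subseteq> V" using S part_in_carrier by blast
  have BV: "B \<subseteq> V" using B SV by blast
  have KK: "\<lbrakk>x, y\<rbrakk> \<in> span B" if "x \<in> span B" "y \<in> span B" for x y
    by (rule br_span[OF that BV subspace_span B(2)])
  obtain v where v: "v \<in> S" "v \<notin> span B" "\<And>u. u \<in> S \<inter> span B \<Longrightarrow> \<lbrakk>u, v\<rbrakk> \<in> span B"
    using acts_nilpotentlyD[OF K subspace_span order_refl assms(6)] KK closed by (metis Int_iff)
  show thesis
  proof (cases "\<lbrakk>v, v\<rbrakk> \<in> span B")
    case False
    have odd: "v \<in> part L 1"
    proof (rule ccontr)
      assume "v \<notin> part L 1"
      then have "v \<in> part L 0" using v(1) S by blast
      then have "\<lbrakk>v, v\<rbrakk> = - \<lbrakk>v, v\<rbrakk>" using skew[of v 0 v 0] by simp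
      then have "2 *s \<lbrakk>v, v\<rbrakk> = 0" by (simp only: scale_two eq_neg_iff_add_eq_0)
      then show False using False span_zero by simp
    qed
    have even: "\<lbrakk>v, v\<rbrakk> \<in> part L 0" using degree[OF odd odd] by simp
    have "\<lbrakk>u, \<lbrakk>v, v\<rbrakk>\<rbrakk> \<in> span B" if u: "u \<in> S \<inter> span B" for u
    proof -
      obtain i where i: "u \<in> part L i" using u S by blast
      have uv: "\<lbrakk>u, v\<rbrakk> \<in> S \<inter> span B" using u v closed by blast
      have "\<lbrakk>v, \<lbrakk>u, v\<rbrakk>\<rbrakk> = - signed (1 * (i + 1)) \<lbrakk>\<lbrakk>u, v\<rbrakk>, v\<rbrakk>"
        by (rule skew[OF odd degree[OF i odd]])
      moreover have uvv: "\<lbrakk>\<lbrakk>u, v\<rbrakk>, v\<rbrakk> \<in> span B" using v(3) uv by blast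
      ultimately have "\<lbrakk>v, \<lbrakk>u, v\<rbrakk>\<rbrakk> \<in> span B" by (simp add: signed_def span_neg)
      then show ?thesis
        using leibniz[OF i odd part_in_carrier[OF odd]] uvv
        by (simp add: signed_def span_add span_diff)
    qed
    moreover have "\<lbrakk>\<lbrakk>v, v\<rbrakk>, \<lbrakk>v, v\<rbrakk>\<rbrakk> = 0"
    proof -
      have "\<lbrakk>\<lbrakk>v, v\<rbrakk>, \<lbrakk>v, v\<rbrakk>\<rbrakk> = - \<lbrakk>\<lbrakk>v, v\<rbrakk>, \<lbrakk>v, v\<rbrakk>\<rbrakk>" using skew[OF even even] by simp
      then have "2 *s \<lbrakk>\<lbrakk>v, v\<rbrakk>, \<lbrakk>v, v\<rbrakk>\<rbrakk> = 0"
        by (simp only: scale_two eq_neg_iff_add_eq_0)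
      then show ?thesis by simp
    qed
    ultimately show thesis using that[of "\<lbrakk>v, v\<rbrakk>"] closed v(1) False span_zero by simp
  qed (use that v in blast)
qed

text \<open>
  Among the subalgebras that are spanned by independent subsets \<open>B\<close> of \<open>S\<close> and act nilpotently, one with
  \<open>B\<close> of maximal cardinality must contain \<open>S\<close>, by the previous two lemmas; its action on \<open>S\<close> modulo
  the zero subspace gives the vector.
\<close>

theorem engel:
  assumes S: "S \<subseteq> part L 0 \<union> part L 1"
    and closed: "\<And>x y. x \<in> S \<Longrightarrow> y \<in> S \<Longrightarrow> \<lbrakk>x, y\<rbrakk> \<in> S"
    and nilpotent: "\<And>x y. x \<in> S \<Longrightarrow> y \<in> S \<Longrightarrow> \<exists>n. (bracket L x ^^ n) y = 0"
    and nontrivial: "\<not> S \<subseteq> {0}"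
  obtains z where "z \<in> S" "z \<noteq> 0" "\<And>x. x \<in> S \<Longrightarrow> \<lbrakk>x, z\<rbrakk> = 0"
proof -
  have SV: "S \<subseteq> V" using S part_in_carrier by blast
  obtain F where F: "finite F" "V = span F" using finite_dim by blast
  define P where "P B \<longleftrightarrow> B \<subseteq> S \<and> independent B \<and> (\<forall>x\<in>B. \<forall>y\<in>B. \<lbrakk>x, y\<rbrakk> \<in> span B) \<and>
    acts_nilpotently S (S \<inter> span B)" for B
  have bound: "finite B \<and> card B \<le> card F" if "P B" for B
    using that independent_span_bound[OF F(1), of B] SV F(2) unfolding P_def by blast
  have "\<lbrakk>0, a\<rbrakk> = 0" if "a \<in> S" for a using that SV by auto
  then have "P {}" unfolding P_def acts_nilpotently_def
    by (fastforce simp: subset_iff subspace_0 independent_empty)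
  moreover have "\<forall>B. P B \<longrightarrow> card B < Suc (card F)"
    using bound by (simp add: less_Suc_eq_le)
  ultimately obtain B where B: "P B" and max: "\<And>B'. P B' \<Longrightarrow> card B' \<le> card B"
    using ex_has_greatest_nat[of P "{}" card] by blast
  have "S \<subseteq> span B"
  proof (rule ccontr)
    assume n: "\<not> S \<subseteq> span B"
    obtain v where v: "v \<in> S" "v \<notin> span B" "\<And>u. u \<in> S \<inter> span B \<Longrightarrow> \<lbrakk>u, v\<rbrakk> \<in> span B" "\<lbrakk>v, v\<rbrakk> \<in> span B"
      using engel_extension[OF S closed _ _ _ n] B unfolding P_def by metis
    have "\<lbrakk>v, u\<rbrakk> \<in> span B" if u: "u \<in> B" for u
    proof -
      have "u \<in> S" using u B by (auto simp: P_def)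
      then obtain i j where "u \<in> part L i" "v \<in> part L j" using v(1) S by blast
      then have "\<lbrakk>v, u\<rbrakk> = - signed (j * i) \<lbrakk>u, v\<rbrakk>" by (intro skew)
      moreover have "\<lbrakk>u, v\<rbrakk> \<in> span B" using v(3) \<open>u \<in> S\<close> u by (auto intro: span_base)
      ultimately show ?thesis by (auto simp: signed_def span_neg)
    qed
    moreover have "\<lbrakk>u, v\<rbrakk> \<in> span B" if "u \<in> B" for u
      using that v(3) B span_base unfolding P_def by blast
    ultimately have "\<forall>x\<in>insert v B. \<forall>y\<in>insert v B. \<lbrakk>x, y\<rbrakk> \<in> span B"
      using v(4) B unfolding P_def by blast
    moreover have "span B \<subseteq> span (insert v B)" by (rule span_mono) blast
    moreover have "acts_nilpotently S (S \<inter> span (insert v B))"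
      using acts_nilpotently_insert[OF S closed nilpotent] B v(1,3) unfolding P_def by blast
    moreover have "independent (insert v B)"
      using B v(2) independent_insertI unfolding P_def by blast
    moreover have "insert v B \<subseteq> S" using B v(1) by (simp add: P_def)
    ultimately have "P (insert v B)" unfolding P_def by blast
    moreover have "v \<notin> B" using v(2) span_base by blast
    ultimately show False using max[of "insert v B"] bound[OF B] by simp
  qed
  then have "acts_nilpotently S S" using B unfolding P_def by (simp add: inf.absorb1)
  moreover have "\<lbrakk>u, w\<rbrakk> \<in> {0}" if "u \<in> S" "w \<in> {0}" for u w
    using that SV by auto
  ultimately obtain z where "z \<in> S" "z \<notin> {0}" "\<And>u. u \<in> S \<Longrightarrow> \<lbrakk>u, z\<rbrakk> \<in> {0}"
    by (rule acts_nilpotentlyD[OF _ subspace_single_0 order_refl nontrivial]) (use closed in blast)+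
  then show thesis using that[of z] by simp
qed

end

section \<open>Central eigenvectors of an odd invertible superderivation\<close>

context lie_superalgebra
begin

definition center :: "'v set" where
  "center = {z \<in> V. \<forall>x\<in>V. \<lbrakk>x, z\<rbrakk> = 0}"

lemma subspace_center: "subspace center"
  by (rule subspaceI) (auto simp: center_def br_add_right br_scale_right)

lemma center_commutes: "z \<in> center \<Longrightarrow> x \<in> V \<Longrightarrow> \<lbrakk>x, z\<rbrakk> = 0"
  by (simp add: center_def)

lemma center_commutes_left:
  assumes z: "z \<in> center" "z \<in> part L i" and x: "x \<in> V"
  shows "\<lbrakk>z, x\<rbrakk> = 0"
proof -
  have zV: "z \<in> V" using z part_in_carrier by blast
  show ?thesis
  proof (rule linear_eq_by_parts[OF x, where h = "\<lambda>_. 0"])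
    show "\<lbrakk>z, u\<rbrakk> = 0" if "u \<in> part L j" for u j
      using skew[OF z(2) that] center_commutes[OF z(1) part_in_carrier[OF that]] by (simp add: signed_def)
  qed (simp_all add: br_add_right zV)
qed

end

locale odd_derivation = lie_superalgebra L
  for L :: "('k::{alg_closed_field, field_char_0}, 'v::ab_group_add, 'm) superalgebra_scheme" +
  fixes \<delta> :: "'v \<Rightarrow> 'v"
  assumes derivation: "superderivation L 1 \<delta>"
begin

lemma \<delta>_add: "x \<in> V \<Longrightarrow> y \<in> V \<Longrightarrow> \<delta> (x + y) = \<delta> x + \<delta> y"
  and \<delta>_scale: "x \<in> V \<Longrightarrow> \<delta> (c *s x) = c *s \<delta> x"
  and \<delta>_part: "x \<in> part L i \<Longrightarrow> \<delta> x \<in> part L (i + 1)"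
  using derivation unfolding superderivation_def linear_on_def by blast+

lemma \<delta>_br:
  assumes "x \<in> part L i" "y \<in> V"
  shows "\<delta> \<lbrakk>x, y\<rbrakk> = \<lbrakk>\<delta> x, y\<rbrakk> + signed i \<lbrakk>x, \<delta> y\<rbrakk>"
proof -
  have "\<delta> \<lbrakk>x, y\<rbrakk> = \<lbrakk>\<delta> x, y\<rbrakk> + signed (1 * i) \<lbrakk>x, \<delta> y\<rbrakk>"
    using derivation assms unfolding superderivation_def by blast
  then show ?thesis by simp
qed

lemma \<delta>_0 [simp]: "\<delta> 0 = 0"
  using \<delta>_scale[of 0 0] by simp

lemma \<delta>_minus: "x \<in> V \<Longrightarrow> \<delta> (- x) = - \<delta> x"
  using \<delta>_scale[of x "- 1"] by simp

lemma \<delta>_diff: "x \<in> V \<Longrightarrow> y \<in> V \<Longrightarrow> \<delta> (x - y) = \<delta> x - \<delta> y"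
  using \<delta>_add[of x "- y"] by (simp add: \<delta>_minus)

lemma \<delta>_in [simp]: "x \<in> V \<Longrightarrow> \<delta> x \<in> V"
proof (erule carrier_cases)
  fix y z assume p: "x = y + z" "y \<in> part L 0" "z \<in> part L 1"
  have "\<delta> y \<in> V" "\<delta> z \<in> V" by (rule part_in_carrier[OF \<delta>_part] p)+
  then show ?thesis using p part_in_carrier by (simp add: \<delta>_add)
qed

lemma \<delta>_square_part: "x \<in> part L i \<Longrightarrow> \<delta> (\<delta> x) \<in> part L i"
  using \<delta>_part[OF \<delta>_part, of x i] bit_cases[of i] by auto

text \<open>
  The square of an odd superderivation is an even derivation: the two mixed terms cancel because \<open>\<delta> x\<close>
  and \<open>x\<close> have opposite parities.
\<close>

lemma \<delta>_square_br:
  assumes x: "x \<in> part L i" and y: "y \<in> V"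
  shows "\<delta> (\<delta> \<lbrakk>x, y\<rbrakk>) = \<lbrakk>\<delta> (\<delta> x), y\<rbrakk> + \<lbrakk>x, \<delta> (\<delta> y)\<rbrakk>"
proof -
  have xV: "x \<in> V" using x part_in_carrier by blast
  have "\<delta> (\<delta> \<lbrakk>x, y\<rbrakk>) = \<delta> \<lbrakk>\<delta> x, y\<rbrakk> + signed i (\<delta> \<lbrakk>x, \<delta> y\<rbrakk>)"
    using xV y by (simp add: \<delta>_br[OF x] \<delta>_add signed_def \<delta>_minus \<delta>_diff)
  then show ?thesis
    using bit_cases[of i] xV y by (auto simp: \<delta>_br[OF \<delta>_part[OF x]] \<delta>_br[OF x])
qed

lemma \<delta>_center:
  assumes z: "z \<in> center"
  shows "\<delta> z \<in> center"
proof -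
  have zV: "z \<in> V" using z by (simp add: center_def)
  have hom: "\<lbrakk>x, \<delta> z\<rbrakk> = 0" if x: "x \<in> part L i" for x i
  proof -
    have "\<delta> \<lbrakk>x, z\<rbrakk> = \<lbrakk>\<delta> x, z\<rbrakk> + signed i \<lbrakk>x, \<delta> z\<rbrakk>" by (rule \<delta>_br[OF x zV])
    then show ?thesis
      using center_commutes[OF z] x part_in_carrier by (auto simp: signed_def split: if_splits)
  qed
  have "\<lbrakk>x, \<delta> z\<rbrakk> = 0" if "x \<in> V" for x
    using that
  proof (rule carrier_cases)
    fix u v assume u: "x = u + v" "u \<in> part L 0" "v \<in> part L 1"
    then show ?thesis using hom[OF u(2)] hom[OF u(3)] zV part_in_carrier by (simp add: br_add_left)
  qed
  then show ?thesis using zV by (simp add: center_def)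
qed

abbreviation gen :: "bit \<Rightarrow> 'k \<Rightarrow> 'v \<Rightarrow> bool" where
  "gen i \<equiv> stable_subspace.gen_eigenvector (smul L) (\<lambda>x. \<delta> (\<delta> x)) (part L i)"

lemma stable_subspace:
  assumes U: "subspace U" "\<And>x. x \<in> U \<inter> part L i \<Longrightarrow> \<delta> (\<delta> x) \<in> U"
  shows "stable_subspace (smul L) (\<lambda>x. \<delta> (\<delta> x)) (U \<inter> part L i) spanning_set"
proof unfold_locales
  show "subspace (U \<inter> part L i)" using U subspace by (intro subspace_inter)
  show "linear_on (smul L) (smul L) (U \<inter> part L i) (\<lambda>x. \<delta> (\<delta> x))"
    using part_in_carrier by (auto simp: linear_on_def \<delta>_add \<delta>_scale)
  show "\<delta> (\<delta> x) \<in> U \<inter> part L i" if "x \<in> U \<inter> part L i" for x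
    using that U \<delta>_square_part by blast
  show "finite spanning_set" by (rule spanning_set)
  show "U \<inter> part L i \<subseteq> span spanning_set" using spanning_set(2) part_in_carrier by blast
qed

lemma stable_part: "stable_subspace (smul L) (\<lambda>x. \<delta> (\<delta> x)) (part L i) spanning_set"
  using stable_subspace[OF subspace_UNIV, of i] by simp

text \<open>
  With \<open>T = \<delta>\<^sup>2\<close>, the operator \<open>T - (\<mu> + \<nu>)\<close> maps \<open>[x, y]\<close> to
  \<open>[(T - \<mu>) x, y] + [x, (T - \<nu>) y]\<close>; a double induction finishes the argument.
\<close>

lemma gen_br:
  assumes "gen i \<mu> x" "gen j \<nu> y"
  shows "gen (i + j) (\<mu> + \<nu>) \<lbrakk>x, y\<rbrakk>"
proof -
  interpret I: stable_subspace "smul L" "\<lambda>x. \<delta> (\<delta> x)" "part L i" spanning_set by (rule stable_part)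
  interpret J: stable_subspace "smul L" "\<lambda>x. \<delta> (\<delta> x)" "part L j" spanning_set by (rule stable_part)
  interpret K: stable_subspace "smul L" "\<lambda>x. \<delta> (\<delta> x)" "part L (i + j)" spanning_set by (rule stable_part)
  show ?thesis
    using assms
  proof (induction \<mu> x arbitrary: y \<nu> rule: I.gen_eigenvector.induct)
    case (zero \<mu>)
    have "y \<in> V" using J.gen_eigenvector_in[OF zero] part_in_carrier by blast
    then have "\<lbrakk>0, y\<rbrakk> = 0" by simp
    then show ?case by (simp only: K.gen_eigenvector.zero)
  next
    case x: (step x \<mu>)
    have xV: "x \<in> V" using x part_in_carrier by blast
    from x.prems show ?case
    proof (induction \<nu> y rule: J.gen_eigenvector.induct)
      case (zero \<nu>)
      have "\<lbrakk>x, 0\<rbrakk> = 0" using xV by simp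
      then show ?case by (simp only: K.gen_eigenvector.zero)
    next
      case y: (step y \<nu>)
      have yV: "y \<in> V" using y part_in_carrier by blast
      have "gen j \<nu> y" using y J.gen_eigenvector.step by blast
      then have "gen (i + j) (\<mu> + \<nu>) (\<lbrakk>\<delta> (\<delta> x) - \<mu> *s x, y\<rbrakk> + \<lbrakk>x, \<delta> (\<delta> y) - \<nu> *s y\<rbrakk>)"
        by (rule K.gen_eigenvector_add[OF x.IH y.IH])
      also have "\<lbrakk>\<delta> (\<delta> x) - \<mu> *s x, y\<rbrakk> + \<lbrakk>x, \<delta> (\<delta> y) - \<nu> *s y\<rbrakk>
          = \<delta> (\<delta> \<lbrakk>x, y\<rbrakk>) - (\<mu> + \<nu>) *s \<lbrakk>x, y\<rbrakk>"
        using xV yV by (simp add: \<delta>_square_br[OF x.hyps(1)] br_diff_left br_diff_right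
            br_scale_left br_scale_right scale_left_distrib)
      finally show ?case
        by (rule K.gen_eigenvector.step[OF degree[OF x.hyps(1) y.hyps(1)]])
    qed
  qed
qed

end

locale odd_invertible_derivation = odd_derivation +
  assumes injective: "inj_on \<delta> V"
begin

lemma \<delta>_eq_0: "x \<in> V \<Longrightarrow> \<delta> x = 0 \<Longrightarrow> x = 0"
  using injective by (metis \<delta>_0 carrier_simps(1) inj_onD)

text \<open>
  The iterates \<open>(ad x)\<^sup>n y\<close> are generalized eigenvectors for the pairwise distinct values
  \<open>\<nu> + n \<mu>\<close>, of which only finitely many are eigenvalues.
\<close>

lemma gen_nilpotent:
  assumes x: "gen i \<mu> x" and y: "gen j \<nu> y"
  shows "\<exists>n. (bracket L x ^^ n) y = 0"
proof (rule ccontr)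
  assume contra: "\<not> ?thesis"
  define E where "E i = stable_subspace.eigenvalues (smul L) (\<lambda>x. \<delta> (\<delta> x)) (part L i)" for i
  have E: "\<kappa> \<in> E l" if "gen l \<kappa> z" "z \<noteq> 0" for l \<kappa> z
    using stable_subspace.gen_eigenvector_eigenvalue[OF stable_part that] by (simp add: E_def)
  have xV: "x \<in> V" and yV: "y \<in> V"
    using x y stable_subspace.gen_eigenvector_in[OF stable_part] part_in_carrier by blast+
  have "x \<noteq> 0"
  proof
    assume "x = 0"
    then have "(bracket L x ^^ 1) y = 0" using yV by simp
    with contra show False by blast
  qed
  have "\<mu> \<noteq> 0"
  proof
    assume "\<mu> = 0"
    with E[OF x \<open>x \<noteq> 0\<close>] obtain z where z: "z \<in> part L i" "z \<noteq> 0" "\<delta> (\<delta> z) = 0"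
      by (auto simp: E_def stable_subspace.eigenvalues_def[OF stable_part])
    then have "z \<in> V" using part_in_carrier by blast
    then show False using \<delta>_eq_0[OF \<delta>_in] \<delta>_eq_0 z by blast
  qed
  have "\<exists>l. gen l (\<nu> + of_nat n * \<mu>) ((bracket L x ^^ n) y)" for n
  proof (induction n)
    case (Suc n)
    then obtain l where "gen l (\<nu> + of_nat n * \<mu>) ((bracket L x ^^ n) y)" ..
    from gen_br[OF x this] show ?case by (auto simp: algebra_simps)
  qed (use y in auto)
  then have "\<exists>l. \<nu> + of_nat n * \<mu> \<in> E l" for n
    using E contra by blast
  then have "\<nu> + of_nat n * \<mu> \<in> E 0 \<union> E 1" for n
    using bit_cases by (metis Un_iff)
  then have "range (\<lambda>n. \<nu> + of_nat n * \<mu>) \<subseteq> E 0 \<union> E 1" by blast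
  moreover have "finite (E 0 \<union> E 1)"
    using stable_subspace.finite_eigenvalues[OF stable_part] by (simp add: E_def)
  moreover have "inj (\<lambda>n. \<nu> + of_nat n * \<mu>)"
    using \<open>\<mu> \<noteq> 0\<close> by (auto intro: injI)
  ultimately show False using range_inj_infinite finite_subset by blast
qed

lemma center_nontrivial:
  assumes "V \<noteq> {0}"
  obtains z i where "z \<in> center" "z \<in> part L i" "z \<noteq> 0"
proof -
  define S where "S = {x. \<exists>i \<mu>. gen i \<mu> x}"
  have S_part: "\<exists>i. x \<in> part L i" if "x \<in> S" for x
    using that stable_subspace.gen_eigenvector_in[OF stable_part] unfolding S_def by blast
  have "part L i \<subseteq> span S" for i
    using stable_subspace.gen_eigenvectors_span[OF stable_part, of i] span_mono[of "{x. \<exists>\<mu>. gen i \<mu> x}" S]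
    unfolding S_def by blast
  then have span: "V \<subseteq> span S" unfolding supercarrier_def using span_add by blast
  have S_le: "S \<subseteq> part L 0 \<union> part L 1"
  proof
    fix x assume "x \<in> S"
    then obtain i where "x \<in> part L i" using S_part by blast
    then show "x \<in> part L 0 \<union> part L 1" using bit_cases[of i] by auto
  qed
  have closed: "\<lbrakk>x, y\<rbrakk> \<in> S" if "x \<in> S" "y \<in> S" for x y
    using that gen_br unfolding S_def by blast
  have nilpotent: "\<exists>n. (bracket L x ^^ n) y = 0" if "x \<in> S" "y \<in> S" for x y
    using that gen_nilpotent unfolding S_def by blast
  have nontrivial: "\<not> S \<subseteq> {0}"
    using assms span span_mono[of S "{0}"] carrier_simps(1) by auto
  obtain z where z: "z \<in> S" "z \<noteq> 0" "\<And>x. x \<in> S \<Longrightarrow> \<lbrakk>x, z\<rbrakk> = 0"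
    using engel[OF S_le closed nilpotent nontrivial] by blast
  obtain i where i: "z \<in> part L i" using S_part z(1) by blast
  have "\<lbrakk>x, z\<rbrakk> = 0" if "x \<in> V" for x
    using br_span_left[of x S "{0}" z] that span z S_part part_in_carrier i subspace_single_0 by blast
  then show thesis using that[OF _ i z(2)] i part_in_carrier by (simp add: center_def)
qed

theorem central_eigenvector:
  assumes "V \<noteq> {0}"
  obtains e lam where "e \<in> center" "e \<in> part L 0" "e \<noteq> 0" "lam \<noteq> 0" "\<delta> (\<delta> e) = (lam * lam) *s e"
proof -
  obtain z i where z: "z \<in> center" "z \<in> part L i" "z \<noteq> 0"
    using center_nontrivial[OF assms] .
  have "\<exists>z. z \<in> center \<inter> part L 0 \<and> z \<noteq> 0"
  proof (cases "i = 0")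
    case False
    then have "i = 1" using bit_cases by blast
    then show ?thesis using z \<delta>_center[OF z(1)] \<delta>_part[OF z(2)] \<delta>_eq_0 part_in_carrier
      by (intro exI[of _ "\<delta> z"]) auto
  qed (use z in auto)
  then obtain z where z: "z \<in> center \<inter> part L 0" "z \<notin> {0}" by blast
  have "stable_subspace (smul L) (\<lambda>x. \<delta> (\<delta> x)) (center \<inter> part L 0) spanning_set"
    using stable_subspace[OF subspace_center] \<delta>_center by blast
  then obtain e \<mu> where e: "e \<in> center \<inter> part L 0" "e \<notin> {0}" "\<delta> (\<delta> e) - \<mu> *s e \<in> {0}"
    using stable_subspace.eigenvector_modulo[OF _ subspace_single_0 z] by blast
  obtain lam where lam: "lam ^ 2 = \<mu>" using nth_root_exists[of 2 \<mu>] by auto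
  have eV: "e \<in> V" using e part_in_carrier by blast
  have "lam \<noteq> 0"
  proof
    assume "lam = 0"
    then have "\<delta> (\<delta> e) = 0" using e(3) lam by simp
    then show False using e(2) \<delta>_eq_0 eV by simp
  qed
  then show thesis using that[of e lam] e lam by (simp add: power2_eq_square)
qed

end

section \<open>The superderivation attached to the two forms\<close>

locale odd_quadratic_even_symplectic_superalgebra = lie_superalgebra g
  for g :: "('k::{alg_closed_field, field_char_0}, 'v::ab_group_add) superalgebra_forms" +
  assumes quadratic: "odd_invariant_scalar_product g (quad g)"
    and symplectic: "even_symplectic_form g (symp g)"

lemma odd_quadratic_even_symplectic_iff:
  "odd_quadratic_even_symplectic g \<longleftrightarrow> odd_quadratic_even_symplectic_superalgebra g"
  by (simp add: odd_quadratic_even_symplectic_def odd_quadratic_even_symplectic_superalgebra_def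
      odd_quadratic_even_symplectic_superalgebra_axioms_def)

context odd_quadratic_even_symplectic_superalgebra
begin

abbreviation quad_form ("B") where "B \<equiv> quad g"
abbreviation symp_form ("\<omega>") where "\<omega> \<equiv> symp g"
notation br ("\<lbrakk>_, _\<rbrakk>")
notation scale (infixr "*s" 75)
notation carrier ("V")

lemma B_add_left: "x \<in> V \<Longrightarrow> y \<in> V \<Longrightarrow> z \<in> V \<Longrightarrow> B (x + y) z = B x z + B y z"
  and B_add_right: "x \<in> V \<Longrightarrow> y \<in> V \<Longrightarrow> z \<in> V \<Longrightarrow> B z (x + y) = B z x + B z y"
  and B_scale_left: "x \<in> V \<Longrightarrow> z \<in> V \<Longrightarrow> B (c *s x) z = c * B x z"
  and B_scale_right: "x \<in> V \<Longrightarrow> z \<in> V \<Longrightarrow> B z (c *s x) = c * B z x"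
  using quadratic unfolding odd_invariant_scalar_product_def bilinear_on_def linear_on_def by blast+

lemma \<omega>_add_left: "x \<in> V \<Longrightarrow> y \<in> V \<Longrightarrow> z \<in> V \<Longrightarrow> \<omega> (x + y) z = \<omega> x z + \<omega> y z"
  and \<omega>_add_right: "x \<in> V \<Longrightarrow> y \<in> V \<Longrightarrow> z \<in> V \<Longrightarrow> \<omega> z (x + y) = \<omega> z x + \<omega> z y"
  and \<omega>_scale_left: "x \<in> V \<Longrightarrow> z \<in> V \<Longrightarrow> \<omega> (c *s x) z = c * \<omega> x z"
  and \<omega>_scale_right: "x \<in> V \<Longrightarrow> z \<in> V \<Longrightarrow> \<omega> z (c *s x) = c * \<omega> z x"
proof -
  have "bilinear_on (smul g) (*) V \<omega>"
    using symplectic unfolding even_symplectic_form_def by blast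
  then show "x \<in> V \<Longrightarrow> y \<in> V \<Longrightarrow> z \<in> V \<Longrightarrow> \<omega> (x + y) z = \<omega> x z + \<omega> y z"
    "x \<in> V \<Longrightarrow> y \<in> V \<Longrightarrow> z \<in> V \<Longrightarrow> \<omega> z (x + y) = \<omega> z x + \<omega> z y"
    "x \<in> V \<Longrightarrow> z \<in> V \<Longrightarrow> \<omega> (c *s x) z = c * \<omega> x z"
    "x \<in> V \<Longrightarrow> z \<in> V \<Longrightarrow> \<omega> z (c *s x) = c * \<omega> z x"
    unfolding bilinear_on_def linear_on_def by blast+
qed

lemma B_0_left [simp]: "z \<in> V \<Longrightarrow> B 0 z = 0"
  and B_0_right [simp]: "z \<in> V \<Longrightarrow> B z 0 = 0"
  using B_scale_left[of 0 z 0] B_scale_right[of 0 z 0] by simp_all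

lemma \<omega>_0_left [simp]: "z \<in> V \<Longrightarrow> \<omega> 0 z = 0"
  and \<omega>_0_right [simp]: "z \<in> V \<Longrightarrow> \<omega> z 0 = 0"
  using \<omega>_scale_left[of 0 z 0] \<omega>_scale_right[of 0 z 0] by simp_all

lemma B_minus_left: "x \<in> V \<Longrightarrow> z \<in> V \<Longrightarrow> B (- x) z = - B x z"
  and B_minus_right: "x \<in> V \<Longrightarrow> z \<in> V \<Longrightarrow> B z (- x) = - B z x"
  using B_scale_left[of x z "- 1"] B_scale_right[of x z "- 1"] by simp_all

lemma \<omega>_minus_left: "x \<in> V \<Longrightarrow> z \<in> V \<Longrightarrow> \<omega> (- x) z = - \<omega> x z"
  and \<omega>_minus_right: "x \<in> V \<Longrightarrow> z \<in> V \<Longrightarrow> \<omega> z (- x) = - \<omega> z x"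
  using \<omega>_scale_left[of x z "- 1"] \<omega>_scale_right[of x z "- 1"] by simp_all

lemma \<omega>_diff_left: "x \<in> V \<Longrightarrow> y \<in> V \<Longrightarrow> z \<in> V \<Longrightarrow> \<omega> (x - y) z = \<omega> x z - \<omega> y z"
  and \<omega>_diff_right: "x \<in> V \<Longrightarrow> y \<in> V \<Longrightarrow> z \<in> V \<Longrightarrow> \<omega> z (x - y) = \<omega> z x - \<omega> z y"
  using \<omega>_add_left[of x "- y" z] \<omega>_add_right[of x "- y" z]
  by (simp_all add: \<omega>_minus_left \<omega>_minus_right)

lemma B_diff_left: "x \<in> V \<Longrightarrow> y \<in> V \<Longrightarrow> z \<in> V \<Longrightarrow> B (x - y) z = B x z - B y z"
  and B_diff_right: "x \<in> V \<Longrightarrow> y \<in> V \<Longrightarrow> z \<in> V \<Longrightarrow> B z (x - y) = B z x - B z y"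
  using B_add_left[of x "- y" z] B_add_right[of x "- y" z]
  by (simp_all add: B_minus_left B_minus_right)

lemmas B_linear = B_add_left B_add_right B_scale_left B_scale_right B_minus_left B_minus_right
  B_diff_left B_diff_right
lemmas br_linear = br_add_left br_add_right br_scale_left br_scale_right br_minus_left
  br_minus_right br_diff_left br_diff_right
lemmas \<omega>_linear = \<omega>_add_left \<omega>_add_right \<omega>_scale_left \<omega>_scale_right
  \<omega>_minus_left \<omega>_minus_right \<omega>_diff_left \<omega>_diff_right

lemma B_same_part: "x \<in> part g i \<Longrightarrow> y \<in> part g i \<Longrightarrow> B x y = 0"
  using quadratic unfolding odd_invariant_scalar_product_def by blast

lemma B_invariant: "x \<in> V \<Longrightarrow> y \<in> V \<Longrightarrow> z \<in> V \<Longrightarrow> B \<lbrakk>x, y\<rbrakk> z = B x \<lbrakk>y, z\<rbrakk>"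
  using quadratic unfolding odd_invariant_scalar_product_def by blast

lemma B_sym_part:
  assumes x: "x \<in> part g i" and y: "y \<in> part g j"
  shows "B x y = B y x"
proof (cases "i = j")
  case True
  then show ?thesis using B_same_part x y by metis
next
  case False
  then have ij: "i * j = 0" using bit_cases[of i] bit_cases[of j] by auto
  have "B x y = signed (i * j) (B y x)"
    using quadratic x y unfolding odd_invariant_scalar_product_def by blast
  then show ?thesis unfolding ij by simp
qed

lemma B_sym:
  assumes "x \<in> V" "y \<in> V"
  shows "B x y = B y x"
proof -
  from assms obtain a b c d where e: "x = a + b" "y = c + d" and
    p: "a \<in> part g 0" "b \<in> part g 1" "c \<in> part g 0" "d \<in> part g 1"
    by (meson carrier_cases)
  then have m: "a \<in> V" "b \<in> V" "c \<in> V" "d \<in> V" by (auto intro: part_in_carrier)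
  have "B a c = B c a" "B a d = B d a" "B b c = B c b" "B b d = B d b"
    by (rule B_sym_part p)+
  then show ?thesis unfolding e using m by (simp add: B_linear)
qed

lemma B_nondegenerate: "x \<in> V \<Longrightarrow> (\<And>y. y \<in> V \<Longrightarrow> B x y = 0) \<Longrightarrow> x = 0"
  using quadratic unfolding odd_invariant_scalar_product_def nondegenerate_on_def by blast

lemma B_extensional:
  assumes "x \<in> V" "x' \<in> V" "\<And>y. y \<in> V \<Longrightarrow> B x y = B x' y"
  shows "x = x'"
  using B_nondegenerate[of "x - x'"] assms by (simp add: B_diff_left)

lemma \<omega>_different_parts: "x \<in> part g i \<Longrightarrow> y \<in> part g j \<Longrightarrow> i \<noteq> j \<Longrightarrow> \<omega> x y = 0"
  and \<omega>_skew: "x \<in> part g i \<Longrightarrow> y \<in> part g j \<Longrightarrow> \<omega> x y = - signed (i * j) (\<omega> y x)"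
  and \<omega>_cocycle: "x \<in> part g i \<Longrightarrow> y \<in> part g j \<Longrightarrow> z \<in> part g l \<Longrightarrow>
    signed (l * i) (\<omega> x \<lbrakk>y, z\<rbrakk>) + signed (i * j) (\<omega> y \<lbrakk>z, x\<rbrakk>) + signed (j * l) (\<omega> z \<lbrakk>x, y\<rbrakk>) = 0"
  using symplectic unfolding even_symplectic_form_def by blast+

lemma \<omega>_nondegenerate: "x \<in> V \<Longrightarrow> (\<And>y. y \<in> V \<Longrightarrow> \<omega> x y = 0) \<Longrightarrow> x = 0"
  using symplectic unfolding even_symplectic_form_def nondegenerate_on_def by blast

text \<open>
  For a basis \<open>b\<close> of the carrier, the endomorphism \<open>z \<mapsto> (\<Sum>v\<in>b. B z v *s v)\<close> is injective by
  non-degeneracy, hence surjective; a preimage of \<open>\<Sum>v\<in>b. \<phi> v *s v\<close> represents \<open>\<phi>\<close>.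
\<close>

lemma riesz:
  assumes \<phi>: "linear_on (smul g) (*) V \<phi>"
  obtains z where "z \<in> V" "\<And>y. y \<in> V \<Longrightarrow> B z y = \<phi> y"
proof -
  obtain b where b: "b \<subseteq> V" "independent b" "V \<subseteq> span b"
    using maximal_independent_subset by blast
  have fin: "finite b"
    using independent_span_bound[OF spanning_set(1) b(2)] b(1) spanning_set(2) by blast
  define R where "R z = (\<Sum>v\<in>b. B z v *s v)" for z
  have R_in: "(\<Sum>v\<in>b. c v *s v) \<in> V" for c
    using b(1) by (intro subspace_sum subspace_carrier) auto
  have "stable_subspace (smul g) R V spanning_set"
  proof unfold_locales
    have "R (x + y) = R x + R y" "R (c *s x) = c *s R x" if "x \<in> V" "y \<in> V" for x y c
      unfolding R_def sum.distrib[symmetric] scale_sum_right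
      using that b(1) by (auto intro!: sum.cong simp: B_linear scale_left_distrib subset_iff)
    then show "linear_on (smul g) (smul g) V R" by (auto simp: linear_on_def)
  qed (use R_in R_def subspace_carrier spanning_set in auto)
  then interpret R: stable_subspace "smul g" R V spanning_set .
  have inj: "z = 0" if "z \<in> V" "R z = 0" for z
  proof (rule B_nondegenerate[OF that(1)])
    fix y assume "y \<in> V"
    have 0: "B z v = 0" if "v \<in> b" for v
      using independentD[OF b(2) fin order_refl, of "B z" v] \<open>R z = 0\<close> that by (simp add: R_def)
    have "y \<in> span b" using \<open>y \<in> V\<close> b(3) by blast
    then have "y \<in> V \<and> B z y = 0"
    proof (induction rule: span_induct_alt)
      case (step c x y)
      then show ?case using 0 b(1) \<open>z \<in> V\<close> by (auto simp: B_linear subset_iff)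
    qed (use \<open>z \<in> V\<close> in auto)
    then show "B z y = 0" ..
  qed
  obtain z where z: "z \<in> V" "R z = (\<Sum>v\<in>b. \<phi> v *s v)"
    using R.injective_imp_surjective[OF inj R_in] by blast
  then have "(\<Sum>v\<in>b. (B z v - \<phi> v) *s v) = 0"
    by (simp add: R_def scale_left_diff_distrib sum_subtractf)
  then have eq: "B z v = \<phi> v" if "v \<in> b" for v
    using independentD[OF b(2) fin order_refl, of "\<lambda>v. B z v - \<phi> v" v] that by simp
  have \<phi>_linear: "\<phi> (x + y) = \<phi> x + \<phi> y" "\<phi> (c *s x) = c * \<phi> x" if "x \<in> V" "y \<in> V" for x y c
    using \<phi> that by (auto simp: linear_on_def)
  have "\<phi> 0 = 0" using \<phi>_linear(2)[of 0 0 0] by simp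
  have "y \<in> V \<and> B z y = \<phi> y" if "y \<in> span b" for y
    using that
  proof (induction rule: span_induct_alt)
    case (step c x y)
    then show ?case using eq b(1) \<open>z \<in> V\<close> by (auto simp: B_linear \<phi>_linear subset_iff)
  qed (use \<open>z \<in> V\<close> \<open>\<phi> 0 = 0\<close> in auto)
  then show thesis using that z(1) b(3) by blast
qed

definition \<delta> :: "'v \<Rightarrow> 'v" where
  "\<delta> x = (SOME z. z \<in> V \<and> (\<forall>y\<in>V. B z y = \<omega> x y))"

lemma \<delta>_in_carrier: "x \<in> V \<Longrightarrow> \<delta> x \<in> V"
  and B_\<delta>: "x \<in> V \<Longrightarrow> y \<in> V \<Longrightarrow> B (\<delta> x) y = \<omega> x y"
proof -
  have "\<delta> x \<in> V \<and> (\<forall>y\<in>V. B (\<delta> x) y = \<omega> x y)" if "x \<in> V" for x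
  proof -
    have "linear_on (smul g) (*) V (\<omega> x)" using that by (auto simp: linear_on_def \<omega>_linear)
    then have "\<exists>z. z \<in> V \<and> (\<forall>y\<in>V. B z y = \<omega> x y)" using riesz by metis
    then show ?thesis unfolding \<delta>_def by (rule someI_ex)
  qed
  then show "x \<in> V \<Longrightarrow> \<delta> x \<in> V" "x \<in> V \<Longrightarrow> y \<in> V \<Longrightarrow> B (\<delta> x) y = \<omega> x y" by blast+
qed

lemma \<delta>_linear_on: "linear_on (smul g) (smul g) V \<delta>"
  unfolding linear_on_def
proof (intro conjI ballI allI)
  show "\<delta> (x + y) = \<delta> x + \<delta> y" if "x \<in> V" "y \<in> V" for x y
    using that by (intro B_extensional) (auto simp: \<delta>_in_carrier B_\<delta> B_linear \<omega>_linear)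
  show "\<delta> (c *s x) = c *s \<delta> x" if "x \<in> V" for x c
    using that by (intro B_extensional) (auto simp: \<delta>_in_carrier B_\<delta> B_linear \<omega>_linear)
qed

lemma B_extensional_part:
  assumes "x \<in> V" "x' \<in> V" "\<And>i y. y \<in> part g i \<Longrightarrow> B x y = B x' y"
  shows "x = x'"
proof (rule B_extensional[OF assms(1,2)])
  fix y assume "y \<in> V"
  then obtain u v where "y = u + v" "u \<in> part g 0" "v \<in> part g 1" by (rule carrier_cases)
  then show "B x y = B x' y"
    using assms part_in_carrier by (auto simp: B_linear)
qed

text \<open>
  The component of \<open>\<delta> x\<close> of the same parity as \<open>x\<close> is orthogonal to everything, because \<open>\<omega>\<close> is even and \<open>B\<close>
  is odd.
\<close>

lemma \<delta>_odd:
  assumes x: "x \<in> part g i"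
  shows "\<delta> x \<in> part g (i + 1)"
proof -
  have xV: "x \<in> V" using x part_in_carrier by blast
  obtain u v where e: "\<delta> x = u + v" "u \<in> part g i" "v \<in> part g (i + 1)"
  proof -
    obtain a b where "\<delta> x = a + b" "a \<in> part g 0" "b \<in> part g 1"
      by (rule carrier_cases[OF \<delta>_in_carrier[OF xV]])
    then show thesis using that[of a b] that[of b a] bit_cases[of i] by (auto simp: add.commute)
  qed
  have uv: "u \<in> V" "v \<in> V" using e part_in_carrier by blast+
  have "u = 0"
  proof (rule B_extensional_part[OF uv(1)])
    fix j y assume y: "y \<in> part g j"
    have yV: "y \<in> V" using y part_in_carrier by blast
    show "B u y = B 0 y"
    proof (cases "j = i")
      case True
      then show ?thesis using B_same_part[OF e(2)] y yV by simp
    next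
      case False
      then have "j = i + 1" using bit_cases[of i] bit_cases[of j] by auto
      then have "B v y = 0" using B_same_part[OF e(3)] y by simp
      moreover have "B u y + B v y = \<omega> x y" using B_\<delta>[OF xV yV] e(1) uv yV by (simp add: B_linear)
      ultimately show ?thesis using \<omega>_different_parts[OF x y] False yV by simp
    qed
  qed auto
  then show ?thesis using e by simp
qed

text \<open>
  Paired with a third vector, and after moving brackets across \<open>B\<close> by invariance, the derivation
  property becomes the cocycle identity of \<open>\<omega>\<close>.
\<close>

lemma \<delta>_derivation_homogeneous:
  assumes x: "x \<in> part g i" and y: "y \<in> part g j"
  shows "\<delta> \<lbrakk>x, y\<rbrakk> = \<lbrakk>\<delta> x, y\<rbrakk> + signed i \<lbrakk>x, \<delta> y\<rbrakk>"
proof (rule B_extensional_part)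
  have V: "x \<in> V" "y \<in> V" using x y part_in_carrier by blast+
  then show "\<delta> \<lbrakk>x, y\<rbrakk> \<in> V" "\<lbrakk>\<delta> x, y\<rbrakk> + signed i \<lbrakk>x, \<delta> y\<rbrakk> \<in> V" by (simp_all add: \<delta>_in_carrier)
  fix l z assume z: "z \<in> part g l"
  have zV: "z \<in> V" using z part_in_carrier by blast
  have 1: "B \<lbrakk>\<delta> x, y\<rbrakk> z = \<omega> x \<lbrakk>y, z\<rbrakk>"
    using V zV by (simp add: B_invariant \<delta>_in_carrier B_\<delta>)
  have 2: "B \<lbrakk>\<delta> y, x\<rbrakk> z = \<omega> y \<lbrakk>x, z\<rbrakk>"
    using V zV by (simp add: B_invariant \<delta>_in_carrier B_\<delta>)
  have 3: "\<lbrakk>x, \<delta> y\<rbrakk> = - signed (i * (j + 1)) \<lbrakk>\<delta> y, x\<rbrakk>"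
    by (rule skew[OF x \<delta>_odd[OF y]])
  have 4: "\<omega> z \<lbrakk>x, y\<rbrakk> = - signed (l * (i + j)) (\<omega> \<lbrakk>x, y\<rbrakk> z)"
    by (rule \<omega>_skew[OF z degree[OF x y]])
  have 5: "\<lbrakk>z, x\<rbrakk> = - signed (l * i) \<lbrakk>x, z\<rbrakk>"
    by (rule skew[OF z x])
  have "B (\<delta> \<lbrakk>x, y\<rbrakk>) z = \<omega> \<lbrakk>x, y\<rbrakk> z" using V zV by (simp add: B_\<delta>)
  moreover have "B (\<lbrakk>\<delta> x, y\<rbrakk> + signed i \<lbrakk>x, \<delta> y\<rbrakk>) z = \<omega> x \<lbrakk>y, z\<rbrakk> - signed (i * j) (\<omega> y \<lbrakk>x, z\<rbrakk>)"
    unfolding 3 using bit_cases[of i] bit_cases[of j] V zV 1 2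
    by (elim disjE) (simp_all add: B_linear \<delta>_in_carrier)
  moreover have "\<omega> \<lbrakk>x, y\<rbrakk> z = \<omega> x \<lbrakk>y, z\<rbrakk> - signed (i * j) (\<omega> y \<lbrakk>x, z\<rbrakk>)"
    using \<omega>_cocycle[OF x y z] bit_cases[of i] bit_cases[of j] bit_cases[of l] V zV
    unfolding 4 5
    by (elim disjE) (simp_all add: \<omega>_linear algebra_simps eq_neg_iff_add_eq_0)
  ultimately show "B (\<delta> \<lbrakk>x, y\<rbrakk>) z = B (\<lbrakk>\<delta> x, y\<rbrakk> + signed i \<lbrakk>x, \<delta> y\<rbrakk>) z" by simp
qed

lemma superderivation_\<delta>: "superderivation g 1 \<delta>"
  unfolding superderivation_def
proof (intro conjI allI ballI)
  fix i x y assume x: "x \<in> part g i" and "y \<in> V"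
  then obtain u v where y: "y = u + v" "u \<in> part g 0" "v \<in> part g 1" using carrier_cases by blast
  have m: "x \<in> V" "u \<in> V" "v \<in> V" using x y part_in_carrier by blast+
  have add: "\<delta> (a + b) = \<delta> a + \<delta> b" if "a \<in> V" "b \<in> V" for a b
    using \<delta>_linear_on that by (auto simp: linear_on_def)
  show "\<delta> \<lbrakk>x, y\<rbrakk> = \<lbrakk>\<delta> x, y\<rbrakk> + signed (1 * i) \<lbrakk>x, \<delta> y\<rbrakk>"
    unfolding y(1) using m \<delta>_derivation_homogeneous[OF x y(2)] \<delta>_derivation_homogeneous[OF x y(3)]
    by (simp add: add br_linear \<delta>_in_carrier signed_def)
next
  show "\<delta> ` part g i \<subseteq> part g (i + 1)" for i using \<delta>_odd by blast
qed (rule \<delta>_linear_on)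

lemma \<delta>_injective: "inj_on \<delta> V"
proof (rule inj_onI)
  fix x y assume m: "x \<in> V" "y \<in> V" and e: "\<delta> x = \<delta> y"
  have "\<omega> (x - y) z = 0" if "z \<in> V" for z
    using B_\<delta>[OF m(1) that] B_\<delta>[OF m(2) that] e \<omega>_add_left[of x "- y" z] m that
    by (simp add: \<omega>_linear)
  then show "x = y" using \<omega>_nondegenerate[of "x - y"] m by simp
qed

lemma associated_superderivation_\<delta>: "associated_superderivation g \<delta>"
proof -
  interpret stable_subspace "smul g" \<delta> V spanning_set
    by unfold_locales (use \<delta>_linear_on \<delta>_in_carrier subspace_carrier spanning_set in auto)
  have "y \<in> \<delta> ` V" if "y \<in> V" for y
    using injective_imp_surjective[OF _ that] \<delta>_injective by (metis T_0 U_simps(1) imageI inj_onD)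
  then have "bij_betw \<delta> V V" using \<delta>_injective \<delta>_in_carrier by (auto simp: bij_betw_def)
  then show ?thesis
    using superderivation_\<delta> B_\<delta> by (simp add: associated_superderivation_def)
qed

end

sublocale odd_quadratic_even_symplectic_superalgebra \<subseteq> odd_invertible_derivation g \<delta>
  by unfold_locales (rule superderivation_\<delta> \<delta>_injective)+

section \<open>Hyperbolic frames around a central plane\<close>

text \<open>
  The vectors \<open>z0, z1\<close> play the roles of \<open>e0*\<close> and \<open>e1*\<close>.  In each pair of dual vectors the
  parities differ, \<open>B\<close> being odd: \<open>z0\<close> is dual to \<open>e1\<close> and \<open>z1\<close> to \<open>e0\<close>.
\<close>

locale hyperbolic_frame = odd_quadratic_even_symplectic_superalgebra g
  for g :: "('k::{alg_closed_field, field_char_0}, 'v::ab_group_add) superalgebra_forms" +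
  fixes z0 z1 e0 e1 :: 'v and lam :: 'k
  assumes central: "z0 \<in> center" "z1 \<in> center"
    and z_part: "z0 \<in> part g 0" "z1 \<in> part g 1"
    and e_part: "e0 \<in> part g 0" "e1 \<in> part g 1"
    and lam_nonzero: "lam \<noteq> 0"
    and \<delta>_z: "\<delta> z0 = lam *s z1" "\<delta> z1 = lam *s z0"
    and pairing: "B z0 e1 = 1" "B z1 e0 = 1" "B z0 z1 = 0" "B e0 e1 = 0"
begin

lemma frame_in [simp]: "z0 \<in> V" "z1 \<in> V" "e0 \<in> V" "e1 \<in> V"
  using z_part e_part part_in_carrier by blast+

lemma B_frame [simp]:
  "B z0 e1 = 1" "B e1 z0 = 1" "B z1 e0 = 1" "B e0 z1 = 1" "B z0 z1 = 0" "B z1 z0 = 0"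
  "B e0 e1 = 0" "B e1 e0 = 0" "B z0 z0 = 0" "B z1 z1 = 0" "B e0 e0 = 0" "B e1 e1 = 0"
  "B z0 e0 = 0" "B e0 z0 = 0" "B z1 e1 = 0" "B e1 z1 = 0"
  using pairing B_sym[of e1 z0] B_sym[of e0 z1] B_sym[of z1 z0] B_sym[of e1 e0]
    B_same_part[OF z_part(1,1)] B_same_part[OF z_part(2,2)] B_same_part[OF e_part(1,1)]
    B_same_part[OF e_part(2,2)] B_same_part[OF z_part(1) e_part(1)] B_same_part[OF e_part(1) z_part(1)]
    B_same_part[OF z_part(2) e_part(2)] B_same_part[OF e_part(2) z_part(2)]
  by simp_all

lemma br_z [simp]: "x \<in> V \<Longrightarrow> \<lbrakk>z0, x\<rbrakk> = 0" "x \<in> V \<Longrightarrow> \<lbrakk>x, z0\<rbrakk> = 0" "x \<in> V \<Longrightarrow> \<lbrakk>z1, x\<rbrakk> = 0" "x \<in> V \<Longrightarrow> \<lbrakk>x, z1\<rbrakk> = 0"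
  using central z_part center_commutes center_commutes_left by blast+

lemma B_br_z [simp]: "x \<in> V \<Longrightarrow> y \<in> V \<Longrightarrow> B \<lbrakk>x, y\<rbrakk> z0 = 0" "x \<in> V \<Longrightarrow> y \<in> V \<Longrightarrow> B \<lbrakk>x, y\<rbrakk> z1 = 0"
  by (simp_all add: B_invariant)

text \<open>
  The orthogonal projection onto the complement \<open>H\<close> of the frame; the coefficient of a frame vector is
  the value of \<open>B\<close> at its dual vector.
\<close>

definition \<pi> :: "'v \<Rightarrow> 'v" where
  "\<pi> x = x - B x e1 *s z0 - B x e0 *s z1 - B x z1 *s e0 - B x z0 *s e1"

definition H :: "'v set" where
  "H = {x \<in> V. B x z0 = 0 \<and> B x z1 = 0 \<and> B x e0 = 0 \<and> B x e1 = 0}"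

lemma subspace_H: "subspace H"
  by (rule subspaceI) (auto simp: H_def B_linear)

lemma \<pi>_in_H [simp]: "x \<in> V \<Longrightarrow> \<pi> x \<in> H"
  by (simp add: H_def \<pi>_def B_linear)

lemma H_in [simp]: "x \<in> H \<Longrightarrow> x \<in> V"
  and B_H_frame [simp]: "x \<in> H \<Longrightarrow> B x z0 = 0" "x \<in> H \<Longrightarrow> B x z1 = 0" "x \<in> H \<Longrightarrow> B x e0 = 0" "x \<in> H \<Longrightarrow> B x e1 = 0"
  by (simp_all add: H_def)

lemma B_frame_H [simp]: "x \<in> H \<Longrightarrow> B z0 x = 0" "x \<in> H \<Longrightarrow> B z1 x = 0" "x \<in> H \<Longrightarrow> B e0 x = 0" "x \<in> H \<Longrightarrow> B e1 x = 0"
  by (simp_all add: B_sym[of _ x])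

lemma H_simps [simp]:
  "0 \<in> H" "x \<in> H \<Longrightarrow> y \<in> H \<Longrightarrow> x + y \<in> H" "x \<in> H \<Longrightarrow> y \<in> H \<Longrightarrow> x - y \<in> H"
  "x \<in> H \<Longrightarrow> - x \<in> H" "x \<in> H \<Longrightarrow> c *s x \<in> H"
  using subspace_H by (auto intro: subspace_0 subspace_add subspace_diff subspace_neg subspace_scale)

lemma decompose: "x = B x e1 *s z0 + B x e0 *s z1 + \<pi> x + B x z1 *s e0 + B x z0 *s e1"
  by (simp add: \<pi>_def)

lemma \<pi>_H [simp]: "x \<in> H \<Longrightarrow> \<pi> x = x"
  by (simp add: \<pi>_def)

lemma \<pi>_frame [simp]: "\<pi> z0 = 0" "\<pi> z1 = 0" "\<pi> e0 = 0" "\<pi> e1 = 0"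
  by (simp_all add: \<pi>_def)

lemma \<pi>_add: "x \<in> V \<Longrightarrow> y \<in> V \<Longrightarrow> \<pi> (x + y) = \<pi> x + \<pi> y"
  and \<pi>_scale: "x \<in> V \<Longrightarrow> \<pi> (c *s x) = c *s \<pi> x"
  by (simp_all add: \<pi>_def B_linear scale_left_distrib scale_right_diff_distrib algebra_simps)

lemma \<pi>_0 [simp]: "\<pi> 0 = 0"
  using \<pi>_scale[of 0 0] by simp

lemma \<pi>_minus: "x \<in> V \<Longrightarrow> \<pi> (- x) = - \<pi> x"
  using \<pi>_scale[of x "- 1"] by simp

lemma \<pi>_diff: "x \<in> V \<Longrightarrow> y \<in> V \<Longrightarrow> \<pi> (x - y) = \<pi> x - \<pi> y"
  using \<pi>_add[of x "- y"] by (simp add: \<pi>_minus)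

lemmas \<pi>_linear = \<pi>_add \<pi>_scale \<pi>_minus \<pi>_diff

lemma \<pi>_part:
  assumes x: "x \<in> part g i"
  shows "\<pi> x \<in> part g i \<inter> H"
proof -
  have "\<pi> x \<in> part g i"
    using bit_cases[of i]
  proof
    assume i: "i = 0"
    then have "B x e0 = 0" "B x z0 = 0" using B_same_part x e_part z_part by blast+
    then show ?thesis using x i e_part z_part by (simp add: \<pi>_def)
  next
    assume i: "i = 1"
    then have "B x e1 = 0" "B x z1 = 0" using B_same_part x e_part z_part by blast+
    then show ?thesis using x i e_part z_part by (simp add: \<pi>_def)
  qed
  then show ?thesis using x part_in_carrier by simp
qed

lemma B_\<pi>_left [simp]: "x \<in> V \<Longrightarrow> y \<in> H \<Longrightarrow> B (\<pi> x) y = B x y"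
  and B_\<pi>_right [simp]: "x \<in> V \<Longrightarrow> y \<in> H \<Longrightarrow> B y (\<pi> x) = B y x"
  by (simp_all add: \<pi>_def B_linear)

text \<open>
  The orthogonal complement of the central plane.  It contains \<open>H\<close>, all brackets and the images of its
  own elements under \<open>\<delta>\<close>; on it, \<open>\<pi>\<close> changes a vector only by a central one.
\<close>

definition W :: "'v set" where
  "W = {x \<in> V. B x z0 = 0 \<and> B x z1 = 0}"

lemma W_in: "x \<in> W \<Longrightarrow> x \<in> V"
  and \<pi>_W: "x \<in> W \<Longrightarrow> \<pi> x = x - B x e1 *s z0 - B x e0 *s z1"
  by (simp_all add: W_def \<pi>_def)

lemma br_in_W [simp]: "x \<in> V \<Longrightarrow> y \<in> V \<Longrightarrow> \<lbrakk>x, y\<rbrakk> \<in> W"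
  by (simp add: W_def)

lemma H_in_W [simp]: "x \<in> H \<Longrightarrow> x \<in> W"
  by (simp add: W_def)

lemma br_\<pi>_left: "x \<in> W \<Longrightarrow> y \<in> V \<Longrightarrow> \<lbrakk>\<pi> x, y\<rbrakk> = \<lbrakk>x, y\<rbrakk>"
  and br_\<pi>_right: "x \<in> W \<Longrightarrow> y \<in> V \<Longrightarrow> \<lbrakk>y, \<pi> x\<rbrakk> = \<lbrakk>y, x\<rbrakk>"
  by (simp_all add: \<pi>_W W_in br_linear)

text \<open>
  The two signs reflect that \<open>\<omega>\<close> is alternating on the even part and symmetric on the odd part.
\<close>

lemma \<omega>_z: "x \<in> V \<Longrightarrow> \<omega> x z0 = - lam * B x z1" "x \<in> V \<Longrightarrow> \<omega> x z1 = lam * B x z0"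
proof -
  show "\<omega> x z0 = - lam * B x z1" if x: "x \<in> V"
  proof (rule linear_eq_by_parts[OF x])
    show "\<omega> u z0 = - lam * B u z1" if u: "u \<in> part g j" for u j
    proof (cases "j = 0")
      case True
      then have "\<omega> u z0 = - \<omega> z0 u" using \<omega>_skew[OF u z_part(1)] by simp
      also have "\<dots> = - lam * B u z1"
        using part_in_carrier[OF u] by (simp flip: B_\<delta> add: \<delta>_z B_linear B_sym)
      finally show ?thesis .
    next
      case False
      then have "j = 1" using bit_cases by blast
      then show ?thesis using \<omega>_different_parts[OF u z_part(1)] B_same_part[of u 1 z1] u z_part by simp
    qed
  qed (simp_all add: \<omega>_linear B_linear algebra_simps)
  show "\<omega> x z1 = lam * B x z0" if x: "x \<in> V"
  proof (rule linear_eq_by_parts[OF x])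
    show "\<omega> u z1 = lam * B u z0" if u: "u \<in> part g j" for u j
    proof (cases "j = 0")
      case True
      then show ?thesis using \<omega>_different_parts[OF u z_part(2)] B_same_part[of u 0 z0] u z_part by simp
    next
      case False
      then have "j = 1" using bit_cases by blast
      then have "\<omega> u z1 = \<omega> z1 u" using \<omega>_skew[OF u z_part(2)] by simp
      also have "\<dots> = lam * B u z0"
        using part_in_carrier[OF u] by (simp flip: B_\<delta> add: \<delta>_z B_linear B_sym)
      finally show ?thesis .
    qed
  qed (simp_all add: \<omega>_linear B_linear algebra_simps)
qed

lemma \<omega>_e: "x \<in> V \<Longrightarrow> \<omega> x e0 = - \<omega> e0 x" "x \<in> V \<Longrightarrow> \<omega> x e1 = \<omega> e1 x"
proof -
  show "\<omega> x e0 = - \<omega> e0 x" if x: "x \<in> V"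
  proof (rule linear_eq_by_parts[OF x])
    show "\<omega> u e0 = - \<omega> e0 u" if u: "u \<in> part g j" for u j
      using \<omega>_skew[OF u e_part(1)] by simp
  qed (simp_all add: \<omega>_linear algebra_simps)
  show "\<omega> x e1 = \<omega> e1 x" if x: "x \<in> V"
  proof (rule linear_eq_by_parts[OF x])
    show "\<omega> u e1 = \<omega> e1 u" if u: "u \<in> part g j" for u j
      using \<omega>_skew[OF u e_part(2)] \<omega>_different_parts[OF u e_part(2)] \<omega>_different_parts[OF e_part(2) u]
        bit_cases[of j] by auto
  qed (simp_all add: \<omega>_linear algebra_simps)
qed

lemma \<delta>_in_W [simp]: "x \<in> W \<Longrightarrow> \<delta> x \<in> W"
  by (auto simp: W_def B_\<delta> \<omega>_z)

lemma \<pi>\<delta>\<pi>: "x \<in> W \<Longrightarrow> \<pi> (\<delta> (\<pi> x)) = \<pi> (\<delta> x)"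
  by (simp add: \<pi>_W[of x] W_in \<delta>_diff \<delta>_scale \<delta>_z \<pi>_linear)

lemma br_e: "x \<in> V \<Longrightarrow> \<lbrakk>x, e0\<rbrakk> = - \<lbrakk>e0, x\<rbrakk>" "\<lbrakk>e0, e0\<rbrakk> = 0" "\<lbrakk>e1, e0\<rbrakk> = - \<lbrakk>e0, e1\<rbrakk>"
proof -
  show *: "\<lbrakk>x, e0\<rbrakk> = - \<lbrakk>e0, x\<rbrakk>" if x: "x \<in> V" for x
  proof (rule linear_eq_by_parts[OF x])
    show "\<lbrakk>u, e0\<rbrakk> = - \<lbrakk>e0, u\<rbrakk>" if u: "u \<in> part g j" for u j
      using skew[OF u e_part(1)] by simp
  qed (simp_all add: br_linear)
  have "\<lbrakk>e0, e0\<rbrakk> + \<lbrakk>e0, e0\<rbrakk> = 0" using *[of e0] by (simp add: eq_neg_iff_add_eq_0)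
  then have "2 *s \<lbrakk>e0, e0\<rbrakk> = 0" by (metis one_add_one scale_left_distrib scale_one)
  then show "\<lbrakk>e0, e0\<rbrakk> = 0" by simp
  show "\<lbrakk>e1, e0\<rbrakk> = - \<lbrakk>e0, e1\<rbrakk>" by (rule *) simp
qed

definition "x0 = \<pi> \<lbrakk>e1, e1\<rbrakk>"
definition "x1 = \<pi> \<lbrakk>e0, e1\<rbrakk>"
definition "c0 = \<pi> (\<delta> e1)"
definition "c1 = \<pi> (\<delta> e0)"
definition "k = B \<lbrakk>e1, e1\<rbrakk> e1"
definition "\<alpha> = \<omega> e1 e1"
definition "D x = \<pi> \<lbrakk>e0, x\<rbrakk>"
definition "Db x = \<pi> \<lbrakk>e1, x\<rbrakk>"

lemma elements_in_H [simp]: "x0 \<in> H" "x1 \<in> H" "c0 \<in> H" "c1 \<in> H"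
  and D_in_H [simp]: "x \<in> V \<Longrightarrow> D x \<in> H" "x \<in> V \<Longrightarrow> Db x \<in> H"
  by (simp_all add: x0_def x1_def c0_def c1_def D_def Db_def)

text \<open>
  Invariance and symmetry turn \<open>B [e, x] e'\<close> into \<open>B [e', e] x\<close>; on \<open>H\<close> only the component of
  \<open>[e', e]\<close> in \<open>H\<close> matters.
\<close>

lemma B_br_e:
  "x \<in> V \<Longrightarrow> B \<lbrakk>e0, x\<rbrakk> e0 = 0" "x \<in> H \<Longrightarrow> B \<lbrakk>e0, x\<rbrakk> e1 = - B x1 x"
  "x \<in> H \<Longrightarrow> B \<lbrakk>e1, x\<rbrakk> e0 = B x1 x" "x \<in> H \<Longrightarrow> B \<lbrakk>e1, x\<rbrakk> e1 = B x0 x"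
proof -
  show "B \<lbrakk>e0, x\<rbrakk> e0 = 0" if "x \<in> V"
    using that B_invariant[of e0 e0 x] by (simp add: B_sym[of _ e0] br_e)
  show "B \<lbrakk>e0, x\<rbrakk> e1 = - B x1 x" if "x \<in> H"
    using that B_invariant[of e1 e0 x] by (simp add: B_sym[of _ e1] br_e x1_def B_linear)
  show "B \<lbrakk>e1, x\<rbrakk> e0 = B x1 x" if "x \<in> H"
    using that B_invariant[of e0 e1 x] by (simp add: B_sym[of _ e0] x1_def)
  show "B \<lbrakk>e1, x\<rbrakk> e1 = B x0 x" if "x \<in> H"
    using that B_invariant[of e1 e1 x] by (simp add: B_sym[of _ e1] x0_def)
qed

lemma B_br_ee: "B \<lbrakk>e0, e1\<rbrakk> e0 = 0" "B \<lbrakk>e0, e1\<rbrakk> e1 = 0" "B \<lbrakk>e1, e1\<rbrakk> e0 = 0"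
  using B_br_e(1)[of e1] B_same_part[OF degree[OF e_part] , of e1]
    B_same_part[OF degree[OF e_part(2,2)], of e0] e_part by simp_all

lemma br_e0_e1: "\<lbrakk>e0, e1\<rbrakk> = x1"
  and br_e1_e1: "\<lbrakk>e1, e1\<rbrakk> = k *s z0 + x0"
  by (simp_all add: x0_def x1_def k_def \<pi>_W B_br_ee)

lemma B_br_H: "x \<in> H \<Longrightarrow> y \<in> H \<Longrightarrow> B \<lbrakk>x, y\<rbrakk> e0 = B (D x) y" "x \<in> H \<Longrightarrow> y \<in> H \<Longrightarrow> B \<lbrakk>x, y\<rbrakk> e1 = B (Db x) y"
  by (simp_all add: D_def Db_def B_invariant B_sym[of _ e0] B_sym[of _ e1])

lemma \<omega>_e0_e0: "\<omega> e0 e0 = 0"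
proof -
  have "\<omega> e0 e0 = - \<omega> e0 e0" using \<omega>_e(1)[of e0] by simp
  then have "2 * \<omega> e0 e0 = 0" by (simp add: eq_neg_iff_add_eq_0)
  then show ?thesis by simp
qed

text \<open>
  The coefficients of \<open>\<delta> e0\<close> and \<open>\<delta> e1\<close> at the frame are values of \<open>\<omega>\<close> on frame vectors.  Those at
  vectors of the wrong parity vanish, and so does the one at \<open>z1\<close> in \<open>\<delta> e0\<close>, because \<open>\<omega> e0 e0 = 0\<close>.
\<close>

lemma \<delta>_e: "\<delta> e0 = c1 - lam *s e1" "\<delta> e1 = \<alpha> *s z0 + c0 + lam *s e0"
proof -
  have "\<delta> e0 \<in> part g 1" "\<delta> e1 \<in> part g 0" using \<delta>_part[OF e_part(1)] \<delta>_part[OF e_part(2)] by simp_all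
  then have "B (\<delta> e0) e1 = 0" "B (\<delta> e1) e0 = 0" using B_same_part e_part by blast+
  then show "\<delta> e0 = c1 - lam *s e1" "\<delta> e1 = \<alpha> *s z0 + c0 + lam *s e0"
    by (simp_all add: c0_def c1_def \<pi>_def B_\<delta> \<omega>_z \<omega>_e0_e0 \<alpha>_def)
qed

end

section \<open>Reduction to the orthogonal complement of a frame\<close>

context hyperbolic_frame
begin

text \<open>
  The reduced algebra: \<open>H\<close> can be viewed as \<open>W\<close> modulo the central plane, and its bracket is the one
  induced on that subquotient.
\<close>

definition h :: "('k, 'v) superalgebra_forms" where
  "h = \<lparr> smul = smul g, part = (\<lambda>i. part g i \<inter> H), bracket = (\<lambda>x y. \<pi> \<lbrakk>x, y\<rbrakk>), quad = B, symp = \<omega> \<rparr>"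

lemma h_simps [simp]:
  "smul h = smul g" "part h i = part g i \<inter> H" "bracket h x y = \<pi> \<lbrakk>x, y\<rbrakk>" "quad h = B" "symp h = \<omega>"
  by (simp_all add: h_def)

lemma carrier_h [simp]: "supercarrier h = H"
proof
  show "supercarrier h \<subseteq> H" by (auto simp: supercarrier_def)
  show "H \<subseteq> supercarrier h"
  proof
    fix x assume x: "x \<in> H"
    then obtain u v where e: "x = u + v" and p: "u \<in> part g 0" "v \<in> part g 1"
      using carrier_cases[OF H_in[OF x]] by blast
    then have "u \<in> V" "v \<in> V" using part_in_carrier by blast+
    then have "x = \<pi> u + \<pi> v" using x e \<pi>_add \<pi>_H by metis
    then show "x \<in> supercarrier h"
      using \<pi>_part[OF p(1)] \<pi>_part[OF p(2)] unfolding supercarrier_def h_simps by blast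
  qed
qed

lemma lie_superalgebra_h: "lie_superalgebra h"
proof (rule lie_superalgebra.intro)
  show "module.subspace (smul h) (part h a)" for a using subspace_inter[OF subspace subspace_H] by simp
  show "part h 0 \<inter> part h 1 = {0}" using direct by auto
  show "\<exists>S. finite S \<and> supercarrier h = module.span (smul h) S"
  proof -
    obtain b where b: "b \<subseteq> H" "independent b" "H \<subseteq> span b"
      using maximal_independent_subset by blast
    have "b \<subseteq> span spanning_set" using b(1) H_in spanning_set(2) by blast
    then have "finite b" using independent_span_bound[OF spanning_set(1) b(2)] by blast
    moreover have "span b = H" using b span_minimal[OF b(1) subspace_H] by blast
    ultimately show ?thesis by auto
  qed
  show "bilinear_on (smul h) (smul h) (supercarrier h) (bracket h)"
    by (simp add: bilinear_on_def linear_on_def br_linear \<pi>_linear)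
  show "bracket h x y \<in> part h (a + b)" if "x \<in> part h a" "y \<in> part h b" for x y a b
    using \<pi>_part[OF degree[of x a y b]] that by simp
  show "bracket h x y = - signed (a * b) (bracket h y x)" if "x \<in> part h a" "y \<in> part h b" for x y a b
    using skew[of x a y b] that by (simp add: signed_def \<pi>_minus)
  show "signed (c * a) (bracket h x (bracket h y z)) + signed (a * b) (bracket h y (bracket h z x))
      + signed (b * c) (bracket h z (bracket h x y)) = 0"
    if p: "x \<in> part h a" "y \<in> part h b" "z \<in> part h c" for x y z a b c
  proof -
    have m: "x \<in> V" "y \<in> V" "z \<in> V" using p by simp_all
    have s: "\<pi> (signed d w) = signed d (\<pi> w)" if "w \<in> V" for d w
      using that by (simp add: signed_def \<pi>_minus)
    have "\<pi> (signed (c * a) \<lbrakk>x, \<lbrakk>y, z\<rbrakk>\<rbrakk> + signed (a * b) \<lbrakk>y, \<lbrakk>z, x\<rbrakk>\<rbrakk> + signed (b * c) \<lbrakk>z, \<lbrakk>x, y\<rbrakk>\<rbrakk>) = 0"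
      using jacobi[of x a y b z c] p by simp
    then show ?thesis using m by (simp add: br_\<pi>_right \<pi>_add s)
  qed
qed (simp add: vector_space)

lemma \<pi>_W_eq_0:
  assumes x: "x \<in> W" "\<pi> x = 0"
  shows "x = B x e1 *s z0 + B x e0 *s z1"
  using assms by (simp add: \<pi>_W diff_eq_eq add.commute)

text \<open>
  If \<open>\<omega> x\<close> vanishes on \<open>H\<close>, then \<open>\<delta> x\<close> lies in the central plane.  This plane is \<open>\<delta>\<close>-stable, so
  injectivity of \<open>\<delta>\<close> puts \<open>x\<close> itself into the plane, which meets \<open>H\<close> only in \<open>0\<close>.
\<close>

lemma \<omega>_nondegenerate_H:
  assumes x: "x \<in> H" and 0: "\<And>y. y \<in> H \<Longrightarrow> \<omega> x y = 0"
  shows "x = 0"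
proof -
  have "B (\<pi> (\<delta> x)) y = B 0 y" if "y \<in> V" for y
  proof -
    have "\<pi> (\<delta> x) \<in> H" using x by simp
    then have "B (\<pi> (\<delta> x)) y = B (\<pi> (\<delta> x)) (\<pi> y)" using that by simp
    also have "\<dots> = \<omega> x (\<pi> y)"
      using B_\<pi>_left[of "\<delta> x" "\<pi> y"] B_\<delta>[of x "\<pi> y"] x that by (simp del: B_\<pi>_left B_\<pi>_right)
    finally show ?thesis using 0 that by simp
  qed
  then have "\<pi> (\<delta> x) = 0" using x by (intro B_extensional) auto
  then have "\<delta> x = B (\<delta> x) e1 *s z0 + B (\<delta> x) e0 *s z1"
    using x by (intro \<pi>_W_eq_0) auto
  also have "\<dots> = \<delta> ((B (\<delta> x) e1 / lam) *s z1 + (B (\<delta> x) e0 / lam) *s z0)"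
    using lam_nonzero by (simp add: \<delta>_add \<delta>_scale \<delta>_z)
  finally have "x = (B (\<delta> x) e1 / lam) *s z1 + (B (\<delta> x) e0 / lam) *s z0"
    using injective x by (auto dest!: inj_onD)
  then have "\<pi> x = \<pi> ((B (\<delta> x) e1 / lam) *s z1 + (B (\<delta> x) e0 / lam) *s z0)" by (rule arg_cong)
  also have "\<dots> = 0" by (simp add: \<pi>_linear)
  finally show ?thesis using x by simp
qed

lemma odd_invariant_scalar_product_h: "odd_invariant_scalar_product h (quad h)"
  unfolding odd_invariant_scalar_product_def
proof (intro conjI)
  show "bilinear_on (smul h) (*) (supercarrier h) (quad h)"
    by (simp add: bilinear_on_def linear_on_def B_linear)
  show "\<forall>i. \<forall>x\<in>part h i. \<forall>y\<in>part h i. quad h x y = 0"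
    unfolding h_simps using B_same_part by blast
  show "\<forall>i j. \<forall>x\<in>part h i. \<forall>y\<in>part h j. quad h x y = signed (i * j) (quad h y x)"
    using quadratic unfolding odd_invariant_scalar_product_def by simp
  show "\<forall>x\<in>supercarrier h. \<forall>y\<in>supercarrier h. \<forall>z\<in>supercarrier h.
      quad h (bracket h x y) z = quad h x (bracket h y z)"
    by (simp add: B_invariant)
  have "x = 0" if x: "x \<in> H" "\<And>y. y \<in> H \<Longrightarrow> B x y = 0" for x
  proof (rule B_nondegenerate)
    show "B x y = 0" if "y \<in> V" for y
      using x(2)[of "\<pi> y"] that x(1) by simp
  qed (use x in simp)
  then show "nondegenerate_on (supercarrier h) (quad h)" by (simp add: nondegenerate_on_def)
qed

lemma even_symplectic_form_h: "even_symplectic_form h (symp h)"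
  unfolding even_symplectic_form_def
proof (intro conjI)
  show "bilinear_on (smul h) (*) (supercarrier h) (symp h)"
    by (simp add: bilinear_on_def linear_on_def \<omega>_linear)
  show "\<forall>i j. i \<noteq> j \<longrightarrow> (\<forall>x\<in>part h i. \<forall>y\<in>part h j. symp h x y = 0)"
    unfolding h_simps using \<omega>_different_parts by blast
  show "\<forall>i j. \<forall>x\<in>part h i. \<forall>y\<in>part h j. symp h x y = - signed (i * j) (symp h y x)"
    using symplectic unfolding even_symplectic_form_def by simp
  show "nondegenerate_on (supercarrier h) (symp h)"
    using \<omega>_nondegenerate_H by (simp add: nondegenerate_on_def)
  have \<omega>_\<pi>: "\<omega> x (\<pi> w) = \<omega> x w" if "x \<in> H" "w \<in> W" for x w
  proof -
    have "\<omega> x (\<pi> w) = \<omega> x w - B w e1 * \<omega> x z0 - B w e0 * \<omega> x z1"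
      using that by (simp add: \<pi>_W W_in \<omega>_linear)
    then show ?thesis using that by (simp add: \<omega>_z)
  qed
  show "\<forall>i j l. \<forall>x\<in>part h i. \<forall>y\<in>part h j. \<forall>z\<in>part h l.
      signed (l * i) (symp h x (bracket h y z)) + signed (i * j) (symp h y (bracket h z x))
      + signed (j * l) (symp h z (bracket h x y)) = 0"
    using \<omega>_cocycle by (simp add: \<omega>_\<pi>)
qed

lemma odd_quadratic_even_symplectic_h: "odd_quadratic_even_symplectic h"
  using lie_superalgebra_h odd_invariant_scalar_product_h even_symplectic_form_h
  by (simp add: odd_quadratic_even_symplectic_def del: h_simps)

text \<open>
  The superderivation attached to the two forms of \<open>h\<close>.  It coincides with the compression of \<open>\<delta>\<close> to \<open>H\<close>, but taking
  it from the general construction gives its bijectivity and derivation property at once.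
\<close>

definition \<delta>h :: "'v \<Rightarrow> 'v" where
  "\<delta>h = odd_quadratic_even_symplectic_superalgebra.\<delta> h"

lemma associated_superderivation_h: "associated_superderivation h \<delta>h"
  and \<delta>h: "x \<in> H \<Longrightarrow> \<delta>h x = \<pi> (\<delta> x)"
proof -
  interpret h: odd_quadratic_even_symplectic_superalgebra h
    using odd_quadratic_even_symplectic_h odd_quadratic_even_symplectic_iff by blast
  show "associated_superderivation h \<delta>h"
    unfolding \<delta>h_def by (rule h.associated_superderivation_\<delta>)
  show "\<delta>h x = \<pi> (\<delta> x)" if x: "x \<in> H"
  proof -
    have "h.\<delta> x \<in> H" using h.\<delta>_in_carrier[of x] x by simp
    moreover have "B (h.\<delta> x) y = B (\<pi> (\<delta> x)) y" if "y \<in> H" for y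
      using h.B_\<delta>[of x y] x that by (simp add: B_\<delta>)
    ultimately show ?thesis unfolding \<delta>h_def
      using x by (intro h.B_extensional) auto
  qed
qed

lemma superderivation_D: "superderivation h 0 D"
  unfolding superderivation_def
proof (intro conjI allI ballI)
  show "linear_on (smul h) (smul h) (supercarrier h) D"
    by (simp add: linear_on_def D_def br_linear \<pi>_linear)
  show "D ` part h i \<subseteq> part h (i + 0)" for i
    using \<pi>_part[OF degree[OF e_part(1), of _ i]] by (auto simp: D_def)
  fix i x y assume "x \<in> part h i" "y \<in> supercarrier h"
  then have x: "x \<in> part g i" "x \<in> V" and y: "y \<in> V" by simp_all
  show "D (bracket h x y) = bracket h (D x) y + signed (0 * i) (bracket h x (D y))"
    using leibniz[OF e_part(1) x(1) y] x y by (simp add: D_def br_\<pi>_left br_\<pi>_right \<pi>_add)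
qed

lemma superderivation_Db: "superderivation h 1 Db"
  unfolding superderivation_def
proof (intro conjI allI ballI)
  show "linear_on (smul h) (smul h) (supercarrier h) Db"
    by (simp add: linear_on_def Db_def br_linear \<pi>_linear)
  show "Db ` part h i \<subseteq> part h (i + 1)" for i
    using \<pi>_part[OF degree[OF e_part(2), of _ i]] by (auto simp: Db_def add.commute simp del: add_bit_eq_xor)
  fix i x y assume "x \<in> part h i" "y \<in> supercarrier h"
  then have x: "x \<in> part g i" "x \<in> V" and y: "y \<in> V" by simp_all
  show "Db (bracket h x y) = bracket h (Db x) y + signed (1 * i) (bracket h x (Db y))"
    using leibniz[OF e_part(2) x(1) y] x y
    by (simp add: Db_def br_\<pi>_left br_\<pi>_right \<pi>_linear signed_def)
qed

lemma skew_D: "skew_supersymmetric h 0 D"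
  unfolding skew_supersymmetric_def
proof (intro allI ballI)
  fix i x y assume "x \<in> part h i" "y \<in> supercarrier h"
  then have m: "x \<in> H" "y \<in> H" by simp_all
  have "B \<lbrakk>x, e0\<rbrakk> y = B x \<lbrakk>e0, y\<rbrakk>" using m by (simp add: B_invariant)
  then have "B \<lbrakk>e0, x\<rbrakk> y = - B x \<lbrakk>e0, y\<rbrakk>"
    using m by (simp add: br_e B_linear) (metis minus_minus)
  then show "quad h (D x) y = - signed (0 * i) (quad h x (D y))"
    using m by (simp add: D_def)
qed

lemma skew_Db: "skew_supersymmetric h 1 Db"
  unfolding skew_supersymmetric_def
proof (intro allI ballI)
  fix i x y assume p: "x \<in> part h i" "y \<in> supercarrier h"
  then have m: "x \<in> H" "y \<in> H" by simp_all
  have "\<lbrakk>e1, x\<rbrakk> = - signed (1 * i) \<lbrakk>x, e1\<rbrakk>" using skew[OF e_part(2)] p by simp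
  moreover have "B \<lbrakk>x, e1\<rbrakk> y = B x \<lbrakk>e1, y\<rbrakk>" using m by (simp add: B_invariant)
  ultimately show "quad h (Db x) y = - signed (1 * i) (quad h x (Db y))"
    using m by (simp add: Db_def B_linear signed_def)
qed

lemma br_x0: "x \<in> V \<Longrightarrow> \<lbrakk>x0, x\<rbrakk> = \<lbrakk>\<lbrakk>e1, e1\<rbrakk>, x\<rbrakk>"
  by (simp add: x0_def br_\<pi>_left)

text \<open>
  The equations between \<open>D\<close>, \<open>Db\<close>, \<open>\<delta>h\<close> and the adjoint actions on the reduced algebra are
  \<open>H\<close>-components of identities that involve the frame vectors; in this case \<open>2 [e1, [e1, x]] = [[e1, e1], x]\<close>.
\<close>

lemma Db_square: "x \<in> H \<Longrightarrow> Db (Db x) = (1/2) *s \<pi> \<lbrakk>x0, x\<rbrakk>"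
proof -
  assume x: "x \<in> H"
  have "\<lbrakk>e1, \<lbrakk>e1, x\<rbrakk>\<rbrakk> = \<lbrakk>\<lbrakk>e1, e1\<rbrakk>, x\<rbrakk> - \<lbrakk>e1, \<lbrakk>e1, x\<rbrakk>\<rbrakk>"
    using leibniz[OF e_part(2,2), of x] x by simp
  then have "\<lbrakk>\<lbrakk>e1, e1\<rbrakk>, x\<rbrakk> = \<lbrakk>e1, \<lbrakk>e1, x\<rbrakk>\<rbrakk> + \<lbrakk>e1, \<lbrakk>e1, x\<rbrakk>\<rbrakk>" by (simp add: eq_diff_eq)
  then have "\<pi> \<lbrakk>x0, x\<rbrakk> = 2 *s Db (Db x)"
    using x by (simp add: br_x0 Db_def br_\<pi>_right \<pi>_add scale_two)
  then show ?thesis by simp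
qed

lemma br_e1_e1_e1: "\<lbrakk>e1, \<lbrakk>e1, e1\<rbrakk>\<rbrakk> = 0" "\<lbrakk>\<lbrakk>e1, e1\<rbrakk>, e1\<rbrakk> = 0"
proof -
  have "\<lbrakk>e1, \<lbrakk>e1, e1\<rbrakk>\<rbrakk> + \<lbrakk>e1, \<lbrakk>e1, e1\<rbrakk>\<rbrakk> = \<lbrakk>\<lbrakk>e1, e1\<rbrakk>, e1\<rbrakk>"
    using leibniz[OF e_part(2,2), of e1] by (simp add: eq_diff_eq)
  moreover have *: "\<lbrakk>\<lbrakk>e1, e1\<rbrakk>, e1\<rbrakk> = - \<lbrakk>e1, \<lbrakk>e1, e1\<rbrakk>\<rbrakk>"
    using skew[OF degree[OF e_part(2,2)] e_part(2)] by simp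
  ultimately have "\<lbrakk>e1, \<lbrakk>e1, e1\<rbrakk>\<rbrakk> + \<lbrakk>e1, \<lbrakk>e1, e1\<rbrakk>\<rbrakk> + \<lbrakk>e1, \<lbrakk>e1, e1\<rbrakk>\<rbrakk> = 0" by simp
  then have "(1 + 1 + 1) *s \<lbrakk>e1, \<lbrakk>e1, e1\<rbrakk>\<rbrakk> = 0" by (simp only: scale_left_distrib scale_one)
  then show "\<lbrakk>e1, \<lbrakk>e1, e1\<rbrakk>\<rbrakk> = 0" by simp
  with * show "\<lbrakk>\<lbrakk>e1, e1\<rbrakk>, e1\<rbrakk> = 0" by simp
qed

lemma Db_x0: "Db x0 = 0"
  by (simp add: Db_def x0_def br_\<pi>_right br_e1_e1_e1)

lemma D_Db: "x \<in> H \<Longrightarrow> supercommutator 0 1 D Db x = \<pi> \<lbrakk>x1, x\<rbrakk>"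
  using leibniz[OF e_part, of x]
  by (simp add: supercommutator_def D_def Db_def x1_def br_\<pi>_left br_\<pi>_right \<pi>_add)

lemma D_x0: "D x0 = 2 *s Db x1"
proof -
  have "\<lbrakk>e0, \<lbrakk>e1, e1\<rbrakk>\<rbrakk> = \<lbrakk>\<lbrakk>e0, e1\<rbrakk>, e1\<rbrakk> + \<lbrakk>e1, \<lbrakk>e0, e1\<rbrakk>\<rbrakk>"
    using leibniz[OF e_part, of e1] by simp
  also have "\<lbrakk>\<lbrakk>e0, e1\<rbrakk>, e1\<rbrakk> = \<lbrakk>e1, \<lbrakk>e0, e1\<rbrakk>\<rbrakk>"
    using skew[OF degree[OF e_part] e_part(2)] by simp
  finally have "\<lbrakk>e0, \<lbrakk>e1, e1\<rbrakk>\<rbrakk> = 2 *s \<lbrakk>e1, \<lbrakk>e0, e1\<rbrakk>\<rbrakk>"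
    by (simp add: scale_two)
  then show ?thesis by (simp add: D_def Db_def x0_def x1_def br_\<pi>_right \<pi>_scale)
qed

lemma B_x0_x1: "B x0 x1 = 0"
proof -
  have "B x0 x1 = B \<lbrakk>e1, e1\<rbrakk> x1" by (simp add: x0_def)
  also have "\<dots> = - B \<lbrakk>e1, e1\<rbrakk> \<lbrakk>e1, e0\<rbrakk>" by (simp add: br_e br_e0_e1 B_linear)
  also have "\<dots> = - B \<lbrakk>\<lbrakk>e1, e1\<rbrakk>, e1\<rbrakk> e0"
    using B_invariant[of "\<lbrakk>e1, e1\<rbrakk>" e1 e0] by simp
  finally show ?thesis by (simp add: br_e1_e1_e1)
qed

lemma \<delta>_br_e1: "x \<in> V \<Longrightarrow> \<delta> \<lbrakk>e1, x\<rbrakk> = \<lbrakk>\<delta> e1, x\<rbrakk> - \<lbrakk>e1, \<delta> x\<rbrakk>"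
  and \<delta>_br_e0: "x \<in> V \<Longrightarrow> \<delta> \<lbrakk>e0, x\<rbrakk> = \<lbrakk>\<delta> e0, x\<rbrakk> + \<lbrakk>e0, \<delta> x\<rbrakk>"
  using \<delta>_br[OF e_part(1)] \<delta>_br[OF e_part(2)] by simp_all

lemma ad_c0: "x \<in> H \<Longrightarrow> \<pi> \<lbrakk>c0, x\<rbrakk> = supercommutator 1 1 \<delta>h Db x - lam *s D x"
  using arg_cong[OF \<delta>_br_e1[of x], of \<pi>]
  by (simp add: supercommutator_def \<delta>h \<pi>\<delta>\<pi> Db_def D_def br_\<pi>_right \<delta>_e br_linear \<pi>_linear algebra_simps)

lemma ad_c1: "x \<in> H \<Longrightarrow> \<pi> \<lbrakk>c1, x\<rbrakk> = supercommutator 1 0 \<delta>h D x + lam *s Db x"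
  using arg_cong[OF \<delta>_br_e0[of x], of \<pi>]
  by (simp add: supercommutator_def \<delta>h \<pi>\<delta>\<pi> Db_def D_def br_\<pi>_right \<delta>_e br_linear \<pi>_linear algebra_simps)

lemma \<delta>_br_e1_e1: "\<delta> \<lbrakk>e1, e1\<rbrakk> = - (2 *s \<lbrakk>e1, c0\<rbrakk>) + (2 * lam) *s x1"
proof -
  have "\<lbrakk>\<delta> e1, e1\<rbrakk> = - \<lbrakk>e1, \<delta> e1\<rbrakk>" using skew[OF \<delta>_part[OF e_part(2)] e_part(2)] by simp
  then have "\<delta> \<lbrakk>e1, e1\<rbrakk> = - \<lbrakk>e1, \<delta> e1\<rbrakk> - \<lbrakk>e1, \<delta> e1\<rbrakk>" using \<delta>_br_e1[of e1] by simp
  also have "\<dots> = - (2 *s \<lbrakk>e1, \<delta> e1\<rbrakk>)" by (simp add: scale_two)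
  finally show ?thesis by (simp add: \<delta>_e br_linear br_e br_e0_e1 scale_right_distrib scale_right_diff_distrib)
qed

lemma \<delta>_x0: "\<delta>h x0 = - (2 *s Db c0) + (2 * lam) *s x1"
proof -
  have "\<delta>h x0 = \<pi> (\<delta> \<lbrakk>e1, e1\<rbrakk>)" by (simp add: \<delta>h) (simp add: x0_def \<pi>\<delta>\<pi>)
  then show ?thesis by (simp add: \<delta>_br_e1_e1 \<pi>_linear Db_def)
qed

lemma \<delta>_x1: "\<delta>h x1 = D c0 + Db c1 - lam *s x0"
proof -
  have "\<lbrakk>c1, e1\<rbrakk> = \<lbrakk>e1, c1\<rbrakk>"
    using skew[OF _ e_part(2), of c1 1] \<pi>_part[OF \<delta>_part[OF e_part(1)]] by (simp add: c1_def)
  moreover have "\<delta>h x1 = \<pi> (\<delta> \<lbrakk>e0, e1\<rbrakk>)" by (simp add: \<delta>h) (simp add: x1_def \<pi>\<delta>\<pi>)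
  ultimately show ?thesis
    by (simp add: \<delta>_br_e0 \<delta>_e br_linear br_e \<pi>_linear D_def Db_def br_e1_e1)
qed

lemma B_\<delta>_e: "x \<in> H \<Longrightarrow> B (\<delta> x) e0 = - B c1 x" "x \<in> H \<Longrightarrow> B (\<delta> x) e1 = B c0 x"
  by (simp_all add: B_\<delta> \<omega>_e c0_def c1_def)

text \<open>
  This compares two computations of the coefficient of \<open>\<delta> [e1, e1]\<close> at \<open>z1\<close>: one from the value of
  \<open>[e1, e1]\<close>, the other from the derivation property.
\<close>

lemma lam_k: "lam * k = B c1 x0 - 2 * B x1 c0"
proof -
  have "B (\<delta> \<lbrakk>e1, e1\<rbrakk>) e0 = lam * k - B c1 x0"
    by (simp add: br_e1_e1 \<delta>_add \<delta>_scale \<delta>_z B_linear B_\<delta>_e)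
  moreover have "B (\<delta> \<lbrakk>e1, e1\<rbrakk>) e0 = - 2 * B x1 c0"
    by (simp add: \<delta>_br_e1_e1 B_linear B_br_e)
  ultimately show ?thesis by (simp add: algebra_simps)
qed

lemma double_extension_data_h: "double_extension_data h \<delta>h D Db x0 x1 c0 c1 k lam"
proof
  show "x0 \<in> part h 0" "c0 \<in> part h 0"
    using \<pi>_part[OF degree[OF e_part(2,2)]] \<pi>_part[OF \<delta>_part[OF e_part(2)]]
    by (simp_all add: x0_def c0_def)
  show "x1 \<in> part h 1" "c1 \<in> part h 1"
    using \<pi>_part[OF degree[OF e_part]] \<pi>_part[OF \<delta>_part[OF e_part(1)]]
    by (simp_all add: x1_def c1_def)
  show "\<forall>x\<in>supercarrier h. Db (Db x) = smul h (1 / 2) (bracket h x0 x)" using Db_square by simp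
qed (use odd_quadratic_even_symplectic_h associated_superderivation_h superderivation_D
    superderivation_Db skew_D skew_Db lam_nonzero Db_x0 D_Db D_x0 B_x0_x1 ad_c0 ad_c1
    \<delta>_x0 \<delta>_x1 lam_k in simp_all)

end

section \<open>The coordinate isomorphism and the dimension count\<close>

context hyperbolic_frame
begin

lemma parity_involution_h:
  assumes "u \<in> part g 0 \<inter> H" "v \<in> part g 1 \<inter> H"
  shows "parity_involution h (u + v) = u - v"
  unfolding parity_involution_def
proof (rule the_equality)
  show "\<exists>x\<in>part h 0. \<exists>y\<in>part h 1. u + v = x + y \<and> u - v = x - y"
    using assms by auto
next
  fix w assume "\<exists>x\<in>part h 0. \<exists>y\<in>part h 1. u + v = x + y \<and> w = x - y"
  then obtain x y where xy: "x \<in> part g 0" "y \<in> part g 1" "u + v = x + y" "w = x - y" by auto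
  have "u - x = y - v" using xy(3) by (simp add: algebra_simps)
  then have "u - x \<in> part g 0 \<inter> part g 1" using xy assms by (metis IntD1 IntI part_simps(3))
  then have "u = x" using direct by auto
  then show "w = u - v" using xy by auto
qed

lemma
  assumes x: "x \<in> H"
  shows parity_in_H [simp]: "parity_involution h x \<in> H"
    and br_e1: "\<lbrakk>x, e1\<rbrakk> = - \<lbrakk>e1, parity_involution h x\<rbrakk>"
proof -
  have "x \<in> supercarrier h" using x by simp
  then obtain u v where e: "x = u + v" and p: "u \<in> part g 0 \<inter> H" "v \<in> part g 1 \<inter> H"
    unfolding supercarrier_def by auto
  have P: "parity_involution h x = u - v" unfolding e by (rule parity_involution_h[OF p])
  show "parity_involution h x \<in> H" using P p by simp
  have "\<lbrakk>u, e1\<rbrakk> = - \<lbrakk>e1, u\<rbrakk>" "\<lbrakk>v, e1\<rbrakk> = \<lbrakk>e1, v\<rbrakk>"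
    using skew[of u 0 e1 1] skew[of v 1 e1 1] p e_part by simp_all
  then show "\<lbrakk>x, e1\<rbrakk> = - \<lbrakk>e1, parity_involution h x\<rbrakk>"
    unfolding P unfolding e using p by (simp add: br_linear)
qed

text \<open>
  The coordinates of a vector along \<open>z0, z1, H, e0, e1\<close>.
\<close>

definition f :: "'v \<Rightarrow> ('k, 'v) ext" where
  "f x = (B x e1, B x e0, \<pi> x, B x z1, B x z0)"

abbreviation E :: "('k, ('k, 'v) ext) superalgebra_forms" where
  "E \<equiv> double_extension h \<delta>h D Db x0 x1 c0 c1 k \<alpha> lam"

lemma f_add: "x \<in> V \<Longrightarrow> y \<in> V \<Longrightarrow> f (x + y) = f x + f y"
  and f_scale: "x \<in> V \<Longrightarrow> f (c *s x) = ext_smul (smul h) c (f x)"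
  by (simp_all add: f_def B_linear \<pi>_linear ext_smul_def)

lemma f_combination:
  "x \<in> H \<Longrightarrow> f (p *s z0 + q *s z1 + x + a *s e0 + b *s e1) = (p, q, x, a, b)"
  by (simp add: f_def B_linear \<pi>_linear)

lemma f_part: "f ` part g i = ext_part h i"
proof (intro subset_antisym subsetI)
  fix y assume "y \<in> f ` part g i"
  then obtain x where x: "x \<in> part g i" "y = f x" by blast
  show "y \<in> ext_part h i"
    using bit_cases[of i]
  proof
    assume i: "i = 0"
    then have "B x e0 = 0" "B x z0 = 0" using B_same_part x(1) e_part z_part by blast+
    then show ?thesis using \<pi>_part[OF x(1)] x(2) i by (simp add: ext_part_def f_def)
  next
    assume i: "i = 1"
    then have "B x e1 = 0" "B x z1 = 0" using B_same_part x(1) e_part z_part by blast+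
    then show ?thesis using \<pi>_part[OF x(1)] x(2) i by (simp add: ext_part_def f_def)
  qed
next
  fix y assume y: "y \<in> ext_part h i"
  show "y \<in> f ` part g i"
    using bit_cases[of i]
  proof
    assume i: "i = 0"
    then obtain p x a where x: "y = (p, 0, x, a, 0)" "x \<in> part g 0" "x \<in> H"
      using y by (auto simp: ext_part_def)
    have "p *s z0 + 0 *s z1 + x + a *s e0 + 0 *s e1 \<in> part g 0" using x z_part e_part by simp
    then show ?thesis using f_combination[OF x(3), of p 0 a 0] x(1) i by (metis imageI)
  next
    assume i: "i = 1"
    then obtain q x b where x: "y = (0, q, x, 0, b)" "x \<in> part g 1" "x \<in> H"
      using y by (auto simp: ext_part_def)
    have "0 *s z0 + q *s z1 + x + 0 *s e0 + b *s e1 \<in> part g 1" using x z_part e_part by simp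
    then show ?thesis using f_combination[OF x(3), of 0 q 0 b] x(1) i by (metis imageI)
  qed
qed

lemma f_bij: "bij_betw f V (supercarrier E)"
proof -
  have "inj_on f V"
  proof (rule inj_onI)
    fix x y assume "f x = f y"
    then show "x = y" using decompose[of x] decompose[of y] by (simp only: f_def prod.inject)
  qed
  moreover have "supercarrier E = f ` V"
  proof -
    have part: "part E i = f ` part g i" for i by (simp add: double_extension_def f_part)
    have "f (u + v) = f u + f v" if "u \<in> part g 0" "v \<in> part g 1" for u v
      using that part_in_carrier f_add by blast
    then show ?thesis unfolding supercarrier_def part by (fastforce simp: image_iff)
  qed
  ultimately show ?thesis by (simp add: bij_betw_def)
qed

lemma br_combination:
  assumes x: "x \<in> H" and y: "y \<in> H"
  shows "\<lbrakk>p *s z0 + q *s z1 + x + a *s e0 + b *s e1, p' *s z0 + q' *s z1 + y + a' *s e0 + b' *s e1\<rbrakk>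
    = \<lbrakk>x, y\<rbrakk> + a *s \<lbrakk>e0, y\<rbrakk> + b *s \<lbrakk>e1, y\<rbrakk> - a' *s \<lbrakk>e0, x\<rbrakk> - b' *s \<lbrakk>e1, parity_involution h x\<rbrakk>
      + (a * b' - b * a') *s x1 + (b * b') *s (k *s z0 + x0)"
  using x y
  by (simp add: br_linear br_e br_e1 br_e0_e1 br_e1_e1 algebra_simps)

lemma f_br:
  assumes x: "x \<in> V" and y: "y \<in> V"
  shows "f \<lbrakk>x, y\<rbrakk> = ext_bracket h D Db x0 x1 k (f x) (f y)"
proof -
  have H: "\<pi> x \<in> H" "\<pi> y \<in> H" using x y by simp_all
  have e: "\<lbrakk>x, y\<rbrakk> = \<lbrakk>\<pi> x, \<pi> y\<rbrakk> + B x z1 *s \<lbrakk>e0, \<pi> y\<rbrakk> + B x z0 *s \<lbrakk>e1, \<pi> y\<rbrakk>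
      - B y z1 *s \<lbrakk>e0, \<pi> x\<rbrakk> - B y z0 *s \<lbrakk>e1, parity_involution h (\<pi> x)\<rbrakk>
      + (B x z1 * B y z0 - B x z0 * B y z1) *s x1 + (B x z0 * B y z0) *s (k *s z0 + x0)"
    using br_combination[OF H] decompose[of x, symmetric] decompose[of y, symmetric] by metis
  show ?thesis
    unfolding e using H
    by (simp add: f_def ext_bracket_def ext_smul_def ext_e0_def ext_e1_def B_linear \<pi>_linear
        B_br_H B_br_e D_def[symmetric] Db_def[symmetric] B_invariant[symmetric] del: B_\<pi>_left)
qed

lemma f_quad: "x \<in> V \<Longrightarrow> y \<in> V \<Longrightarrow> B x y = ext_quad h (f x) (f y)"
proof -
  assume m: "x \<in> V" "y \<in> V"
  have "B x y = B (B x e1 *s z0 + B x e0 *s z1 + \<pi> x + B x z1 *s e0 + B x z0 *s e1) y"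
    using decompose[of x] by metis
  also have "\<dots> = B (\<pi> x) (\<pi> y) + B x e1 * B y z0 + B x z0 * B y e1 + B x e0 * B y z1 + B x z1 * B y e0"
    using m B_sym[of _ y] by (simp add: B_linear)
  finally show ?thesis by (simp add: ext_quad_def f_def)
qed

lemma \<delta>_combination:
  assumes x: "x \<in> H"
  shows "\<delta> (p *s z0 + q *s z1 + x + a *s e0 + b *s e1)
    = (p * lam) *s z1 + (q * lam) *s z0 + \<delta> x + a *s (c1 - lam *s e1) + b *s (\<alpha> *s z0 + c0 + lam *s e0)"
  using x by (simp add: \<delta>_add \<delta>_scale \<delta>_z \<delta>_e)

lemma f_\<delta>:
  assumes x: "x \<in> V"
  shows "f (\<delta> x) = ext_delta h \<delta>h c0 c1 \<alpha> lam (f x)"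
proof -
  have H: "\<pi> x \<in> H" using x by simp
  have e: "\<delta> x = (B x e1 * lam) *s z1 + (B x e0 * lam) *s z0 + \<delta> (\<pi> x)
      + B x z1 *s (c1 - lam *s e1) + B x z0 *s (\<alpha> *s z0 + c0 + lam *s e0)"
    using \<delta>_combination[OF H] decompose[of x, symmetric] by metis
  have W: "B (\<delta> (\<pi> x)) z0 = 0" "B (\<delta> (\<pi> x)) z1 = 0" using \<delta>_in_W[OF H_in_W[OF H]] by (simp_all add: W_def)
  show ?thesis
    unfolding e using H W
    by (simp add: f_def ext_delta_def ext_smul_def B_linear \<pi>_linear B_\<delta>_e \<delta>h algebra_simps)
qed

lemma form_isomorphic_double_extension: "form_isomorphic g E"
  unfolding form_isomorphic_def
proof (intro exI[of _ f] conjI ballI allI)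
  show "bij_betw f V (supercarrier E)" by (rule f_bij)
  show "linear_on (smul g) (smul E) V f"
    by (simp add: linear_on_def f_add f_scale double_extension_def)
  show "f ` part g i = part E i" for i by (simp add: f_part double_extension_def)
  fix x y assume m: "x \<in> V" "y \<in> V"
  show "f \<lbrakk>x, y\<rbrakk> = bracket E (f x) (f y)" using f_br m by (simp add: double_extension_def)
  show "B x y = quad E (f x) (f y)" using f_quad m by (simp add: double_extension_def)
  have "\<omega> x y = B (\<delta> x) y" using m by (simp add: B_\<delta>)
  also have "\<dots> = ext_quad h (ext_delta h \<delta>h c0 c1 \<alpha> lam (f x)) (f y)"
    using f_quad[of "\<delta> x" y] m by (simp add: f_\<delta>)
  finally show "\<omega> x y = symp E (f x) (f y)" by (simp add: double_extension_def)
qed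

lemma not_in_span:
  assumes "x \<in> V" "S \<subseteq> V" "e \<in> V" "B x e = 1" "\<And>s. s \<in> S \<Longrightarrow> B s e = 0"
  shows "x \<notin> span S"
proof
  assume "x \<in> span S"
  moreover have "subspace {v \<in> V. B v e = 0}" using assms(3) by (intro subspaceI) (auto simp: B_linear)
  moreover have "S \<subseteq> {v \<in> V. B v e = 0}" using assms(2,5) by blast
  ultimately have "B x e = 0" using span_minimal by blast
  then show False using assms(4) by simp
qed

text \<open>
  Each frame vector, added to a basis of \<open>H\<close> in the order \<open>z0, z1, e0, e1\<close>, pairs to \<open>1\<close> with its dual
  vector, which is orthogonal to all basis elements that precede it.
\<close>

lemma dim_h: "vector_space.dim (smul h) (supercarrier h) + 4 = vector_space.dim (smul g) (supercarrier g)"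
proof -
  obtain b where b: "b \<subseteq> H" "independent b" "H \<subseteq> span b"
    using maximal_independent_subset by blast
  have bV: "b \<subseteq> V" using b(1) by auto
  have "b \<subseteq> span spanning_set" using bV spanning_set(2) by blast
  then have fin: "finite b" using independent_span_bound[OF spanning_set(1) b(2)] by blast
  have bH: "x \<in> H" if "x \<in> b" for x using that b(1) by blast
  have n: "z0 \<notin> span b" "z1 \<notin> span (insert z0 b)" "e0 \<notin> span (insert z1 (insert z0 b))"
    "e1 \<notin> span (insert e0 (insert z1 (insert z0 b)))"
    by (rule not_in_span[where e = e1] not_in_span[where e = e0]
        not_in_span[where e = z1] not_in_span[where e = z0]; use bV bH in auto)+
  let ?b = "insert e1 (insert e0 (insert z1 (insert z0 b)))"
  have "independent ?b" using n b(2) by (intro independent_insertI)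
  moreover have "span ?b = span V"
  proof
    show "span ?b \<subseteq> span V" using bV by (intro span_mono) auto
    have "x \<in> span ?b" if "x \<in> V" for x
    proof -
      have "\<pi> x \<in> span b" using that b(3) by auto
      then have \<pi>: "\<pi> x \<in> span ?b" using span_mono[of b ?b] by blast
      have "B x e1 *s z0 + B x e0 *s z1 + \<pi> x + B x z1 *s e0 + B x z0 *s e1 \<in> span ?b"
        by (intro span_add span_scale \<pi>) (auto intro: span_base)
      then show ?thesis using decompose[of x] by metis
    qed
    then have "V \<subseteq> span ?b" by blast
    then show "span V \<subseteq> span ?b" by (rule span_minimal[OF _ subspace_span])
  qed
  ultimately have "dim V = card ?b" by (metis dim_eq_card)
  also have "\<dots> = card b + 4"
    using n fin span_base by (auto simp: card_insert_if)
  also have "card b = dim H" using b span_minimal[OF b(1) subspace_H] span_eq_iff[of H] subspace_H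
    by (metis dim_eq_card subset_antisym)
  finally show ?thesis by simp
qed

end

context odd_quadratic_even_symplectic_superalgebra
begin

text \<open>
  Non-degeneracy gives a homogeneous vector that pairs non-trivially with \<open>x\<close>; as \<open>B\<close> is odd, its parity
  differs from that of \<open>x\<close>.
\<close>

lemma B_partner:
  assumes x: "x \<in> part g i" "x \<noteq> 0"
  obtains y where "y \<in> part g (i + 1)" "B x y = 1"
proof -
  have xV: "x \<in> V" using x part_in_carrier by blast
  obtain j y where y: "y \<in> part g j" "B x y \<noteq> 0"
    using B_extensional_part[OF xV carrier_simps(1)] x(2) part_in_carrier by (metis B_0_left)
  have "j = i + 1" using B_same_part[OF x(1), of y] y bit_cases[of i] bit_cases[of j] by auto
  then show thesis
    using that[of "inverse (B x y) *s y"] y xV part_in_carrier[OF y(1)] by (simp add: B_linear)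
qed

lemma ex_hyperbolic_frame:
  assumes "V \<noteq> {0}"
  obtains z0 z1 e0 e1 lam where "hyperbolic_frame g z0 z1 e0 e1 lam"
proof -
  obtain z0 lam where z0: "z0 \<in> center" "z0 \<in> part g 0" "z0 \<noteq> 0" and lam: "lam \<noteq> 0"
    and eigen: "\<delta> (\<delta> z0) = (lam * lam) *s z0"
    using central_eigenvector[OF assms] .
  have z0V: "z0 \<in> V" using z0 part_in_carrier by blast
  define z1 where "z1 = inverse lam *s \<delta> z0"
  have \<delta>z: "\<delta> z0 = lam *s z1" "\<delta> z1 = lam *s z0"
    using lam z0V eigen by (simp_all add: z1_def \<delta>_scale)
  have z1: "z1 \<in> center" "z1 \<in> part g 1"
    using \<delta>_center[OF z0(1)] subspace_scale[OF subspace_center] \<delta>_part[OF z0(2)] by (simp_all add: z1_def)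
  have z1V: "z1 \<in> V" using z1 part_in_carrier by blast
  have "z1 \<noteq> 0" using \<delta>z(1) \<delta>_eq_0[OF z0V] z0(3) by auto
  have zz: "B z0 z1 = 0"
  proof -
    have "\<omega> z0 z0 = - \<omega> z0 z0" using \<omega>_skew[OF z0(2,2)] by simp
    then have "2 * \<omega> z0 z0 = 0" by (simp add: eq_neg_iff_add_eq_0)
    then have "B (\<delta> z0) z0 = 0" using z0V by (simp add: B_\<delta>)
    then show ?thesis using z0V z1V lam B_sym[of z1 z0] by (simp add: \<delta>z B_linear)
  qed
  obtain u where u: "u \<in> part g 1" "B z0 u = 1" using B_partner[OF z0(2,3)] by auto
  obtain e0 where e0: "e0 \<in> part g 0" "B z1 e0 = 1" using B_partner[OF z1(2) \<open>z1 \<noteq> 0\<close>] by auto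
  \<comment> \<open>Subtracting a multiple of \<open>z1\<close> makes \<open>e1\<close> orthogonal to \<open>e0\<close> without affecting its pairing with \<open>z0\<close>.\<close>
  define e1 where "e1 = u - B e0 u *s z1"
  have m: "u \<in> V" "e0 \<in> V" using u e0 part_in_carrier by blast+
  have "hyperbolic_frame g z0 z1 e0 e1 lam"
  proof
    show "e1 \<in> part g 1" using u z1 by (simp add: e1_def)
    show "B z0 e1 = 1" "B e0 e1 = 0" using m z0V z1V u e0 zz B_sym[of e0 z1] by (simp_all add: e1_def B_linear)
  qed (use z0 z1 e0 lam \<delta>z zz in auto)
  then show thesis using that by blast
qed

end

theorem proposition4p7:
  fixes g :: "('k::{alg_closed_field, field_char_0}, 'v::ab_group_add) superalgebra_forms"
  assumes "odd_quadratic_even_symplectic g"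
    and "supercarrier g \<noteq> {0}"
  shows "\<exists>h :: ('k, 'v) superalgebra_forms.
           odd_quadratic_even_symplectic h \<and>
           vector_space.dim (smul h) (supercarrier h) + 4 = vector_space.dim (smul g) (supercarrier g) \<and>
           generalized_odd_double_extension g h"
proof -
  interpret odd_quadratic_even_symplectic_superalgebra g
    using assms(1) odd_quadratic_even_symplectic_iff by blast
  obtain z0 z1 e0 e1 lam where "hyperbolic_frame g z0 z1 e0 e1 lam"
    using ex_hyperbolic_frame[OF assms(2)] .
  then interpret frame: hyperbolic_frame g z0 z1 e0 e1 lam .
  have "generalized_odd_double_extension g frame.h"
    unfolding generalized_odd_double_extension_def
    using frame.double_extension_data_h frame.form_isomorphic_double_extension by blast
  then show ?thesis
    using frame.odd_quadratic_even_symplectic_h frame.dim_h by blast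
qed

end
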